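(* Let $G=(\mathcal V,\mathcal E)$ be the graph with $\mathcal V=\{1,2,3,4\}$ and edges $\{1,2\},\{2,3\},\{2,4\},\{3,4\}$, and consider only arrival probabilities $\mu\in\mathcal M^+(\mathcal V)$ with $\mu(3)=\mu(4)$. Let $\mathrm{Ncond}(G)$, $\mathrm{Stab}(A)$ and $\mathrm{Stab}(B)$ denote respectively the set of such $\mu$ satisfying the condition $\mathrm{Ncond}(G)$, the set of such $\mu$ for which the matching model on $G$ with priority policy $A$ is stable, and the set of such $\mu$ for which the matching model on $G$ with priority policy $B$ is stable. Then $$\mathrm{Stab}(A)=\mathrm{Ncond}(G)\cap\bigl\{\mu : \mu(1)(1-\mu(1))<\mu(2)^2\bigr\},\qquad \mathrm{Stab}(B)=\mathrm{Ncond}(G).$$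
   Context: $\mathcal M^+(\mathcal V)$ is the set of probability measures $\mu$ on $\mathcal V$ with $\mu(i)>0$ for all $i\in\mathcal V$. Write $u\sim v$ if $u,v$ are adjacent; for $U\subset\mathcal V$, $\mathcal E(U)=\{v\in\mathcal V : \exists u\in U,\ u\sim v\}$ and $\mathcal E(u)=\mathcal E(\{u\})$. An independent set is a non-empty subset of $\mathcal V$ containing no pair of adjacent vertices. A measure $\mu\in\mathcal M^+(\mathcal V)$ satisfies $\mathrm{Ncond}(G)$ if $\mu(\mathcal I)<\mu(\mathcal E(\mathcal I))$ for every independent set $\mathcal I$ of $G$. Matching model with a priority policy: the buffer-content is described by the vector counting the items of each class, in the state space $[\mathcal U]=\{u\in\mathbb N^{\mathcal V} : u_iu_j=0 \text{ whenever } i\sim j\}$. For each $i\in\mathcal V$, a total order on $\mathcal E(i)$ is given (the preferences of $i$). With $e_i$ the $i$-th canonical basis vector, the priority policy is the map $\Phi:[\mathcal U]\times\mathcal V\to[\mathcal U]$ given by $\Phi(u,i)=u+e_i$ if $u_j=0$ for all $j\in\mathcal E(i)$, and otherwise $\Phi(u,i)=u-e_j$, where $j$ is the maximum, with respect to the preferences of $i$, of the (non-empty) set $\{k\in\mathcal E(i): u_k>0\}$. Let $(v_n)_{n\in\mathbb N}$ be i.i.d. with law $\mu$, start from the empty buffer $U_0=0$, and set $U_{n+1}=\Phi(U_n,v_n)$. The model is stable if the Markov chain $(U_n)_{n\in\mathbb N}$ is positive recurrent. Policy $A$ is a priority policy in which class $2$ gives priority to classes $3$ and $4$ over class $1$;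 policy $B$ is a priority policy in which class $2$ gives priority to class $1$ over classes $3$ and $4$. (Since adjacent classes are never simultaneously present in the buffer, the other preferences play no role.) *)

theory Defs
  imports "HOL-Probability.Probability"
begin

section \<open>Finite simple graphs\<close>

record 'v ugraph =
  verts :: "'v set"
  edges :: "'v set set"

definition simple_graph :: "'v ugraph \<Rightarrow> bool" where
  "simple_graph G \<longleftrightarrow> finite (verts G) \<and> (\<forall>e\<in>edges G. e \<subseteq> verts G \<and> card e = 2)"

definition adjacent :: "'v ugraph \<Rightarrow> 'v \<Rightarrow> 'v \<Rightarrow> bool" where
  "adjacent G u v \<longleftrightarrow> {u, v} \<in> edges G"

definition neighbours :: "'v ugraph \<Rightarrow> 'v set \<Rightarrow> 'v set" where
  "neighbours G U = {v \<in> verts G. \<exists>u\<in>U. adjacent G u v}"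

definition independent_vertices :: "'v ugraph \<Rightarrow> 'v set \<Rightarrow> bool" where
  "independent_vertices G I \<longleftrightarrow>
     I \<noteq> {} \<and> I \<subseteq> verts G \<and> (\<forall>i\<in>I. \<forall>j\<in>I. \<not> adjacent G i j)"


section \<open>Arrival laws\<close>

text \<open>The probability measures on the finite set \<open>V\<close> that charge every point of \<open>V\<close>,
  viewed as mass functions on the ambient type vanishing off \<open>V\<close>.\<close>

definition full_support_laws :: "'v set \<Rightarrow> 'v pmf set" where
  "full_support_laws V = {\<mu>. set_pmf \<mu> = V}"

definition Ncond :: "'v ugraph \<Rightarrow> 'v pmf \<Rightarrow> bool" where
  "Ncond G \<mu> \<longleftrightarrow>
     (\<forall>I. independent_vertices G I \<longrightarrow>
        measure (measure_pmf \<mu>) I < measure (measure_pmf \<mu>) (neighbours G I))"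


section \<open>Priority policies\<close>

text \<open>Vectors indexed by the vertices are functions on the ambient type that vanish off the
  vertex set.\<close>

definition buffer_states :: "'v ugraph \<Rightarrow> ('v \<Rightarrow> nat) set" where
  "buffer_states G =
     {u. (\<forall>i. i \<notin> verts G \<longrightarrow> u i = 0) \<and> (\<forall>i j. adjacent G i j \<longrightarrow> u i * u j = 0)}"

text \<open>\<open>(j, k) \<in> pref i\<close> means that class \<open>i\<close> likes \<open>k\<close> at least as much as \<open>j\<close>.\<close>

definition preferences :: "'v ugraph \<Rightarrow> ('v \<Rightarrow> 'v rel) \<Rightarrow> bool" where
  "preferences G pref \<longleftrightarrow> (\<forall>i\<in>verts G. linear_order_on (neighbours G {i}) (pref i))"

definition greatest_wrt :: "'v rel \<Rightarrow> 'v set \<Rightarrow> 'v" where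
  "greatest_wrt r K = (THE j. j \<in> K \<and> (\<forall>k\<in>K. (k, j) \<in> r))"

definition priority_step ::
  "'v ugraph \<Rightarrow> ('v \<Rightarrow> 'v rel) \<Rightarrow> ('v \<Rightarrow> nat) \<Rightarrow> 'v \<Rightarrow> ('v \<Rightarrow> nat)" where
  "priority_step G pref u i =
     (let K = {k \<in> neighbours G {i}. u k > 0}
      in if K = {} then u(i := u i + 1)
         else let j = greatest_wrt (pref i) K in u(j := u j - 1))"

lemma greatest_wrt:
  assumes "linear_order_on A r" "K \<subseteq> A" "finite K" "K \<noteq> {}"
  shows "greatest_wrt r K \<in> K" "\<And>k. k \<in> K \<Longrightarrow> (k, greatest_wrt r K) \<in> r"
proof -
  have refl: "\<And>a. a \<in> A \<Longrightarrow> (a, a) \<in> r" and tr: "trans r" and anti: "antisym r"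
    and tot: "total_on A r"
    using assms(1) by (auto simp: order_on_defs refl_on_def)
  have "\<exists>j\<in>K. \<forall>k\<in>K. (k, j) \<in> r"
    using assms(3,4,2)
  proof (induction K rule: finite_ne_induct)
    case (singleton x)
    then show ?case using refl by auto
  next
    case (insert x F)
    then obtain j where j: "j \<in> F" "\<forall>k\<in>F. (k, j) \<in> r" by auto
    have "x \<in> A" "j \<in> A" using insert.prems j by auto
    then consider "(x, j) \<in> r" | "(j, x) \<in> r"
      using tot refl by (cases "x = j") (auto simp: total_on_def)
    then show ?case
    proof cases
      case 1
      then show ?thesis using j by auto
    next
      case 2
      then have "\<forall>k\<in>F. (k, x) \<in> r" using j by (blast intro: transD[OF tr])
      then show ?thesis using refl \<open>x \<in> A\<close> by auto
    qed
  qed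
  then have "\<exists>!j. j \<in> K \<and> (\<forall>k\<in>K. (k, j) \<in> r)"
    by (blast dest: antisymD[OF anti])
  from theI'[OF this]
  show "greatest_wrt r K \<in> K" "\<And>k. k \<in> K \<Longrightarrow> (k, greatest_wrt r K) \<in> r"
    unfolding greatest_wrt_def by blast+
qed

lemma priority_step_in_buffer_states:
  assumes "simple_graph G" "u \<in> buffer_states G" "i \<in> verts G"
  shows "priority_step G pref u i \<in> buffer_states G"
proof (cases "{k \<in> neighbours G {i}. u k > 0} = {}")
  case True
  have noloop: "\<not> adjacent G i i"
  proof
    assume "adjacent G i i"
    then have "card {i} = 2"
      using assms(1) unfolding simple_graph_def adjacent_def by simp
    then show False by simp
  qed
  have vert: "adjacent G i k \<Longrightarrow> k \<in> verts G" for k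
    using assms(1) by (auto simp: simple_graph_def adjacent_def)
  have sym: "adjacent G k i \<longleftrightarrow> adjacent G i k" for k
    by (simp add: adjacent_def insert_commute)
  have zero: "u k = 0" if "adjacent G i k" for k
    using that True vert by (auto simp: neighbours_def)
  have step: "priority_step G pref u i = u(i := u i + 1)"
    unfolding priority_step_def Let_def by (simp only: True simp_thms if_True)
  have "(u(i := u i + 1)) j * (u(i := u i + 1)) k = 0" if jk: "adjacent G j k" for j k
  proof -
    consider "j = i" "k \<noteq> i" | "k = i" "j \<noteq> i" | "j \<noteq> i" "k \<noteq> i"
      using jk noloop by blast
    then show ?thesis
    proof cases
      case 1
      then show ?thesis using zero[of k] jk by simp
    next
      case 2
      then show ?thesis using zero[of j] sym[of j] jk by simp
    next
      case 3
      then show ?thesis using assms(2) jk by (simp add: buffer_states_def)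
    qed
  qed
  moreover have "(u(i := u i + 1)) j = 0" if "j \<notin> verts G" for j
    using that assms(2,3) by (auto simp: buffer_states_def)
  ultimately show ?thesis
    unfolding step buffer_states_def by blast
next
  case False
  let ?j = "greatest_wrt (pref i) {k \<in> neighbours G {i}. u k > 0}"
  have "priority_step G pref u i = u(?j := u ?j - 1)"
    unfolding priority_step_def Let_def by (simp only: False if_False)
  then have le: "priority_step G pref u i k \<le> u k" for k
    by simp
  show ?thesis
    unfolding buffer_states_def
  proof (intro CollectI conjI allI impI)
    fix k assume "k \<notin> verts G"
    then show "priority_step G pref u i k = 0"
      using assms(2) le[of k] by (simp add: buffer_states_def)
  next
    fix j k assume "adjacent G j k"
    then have "u j = 0 \<or> u k = 0"
      using assms(2) by (simp add: buffer_states_def)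
    then show "priority_step G pref u i j * priority_step G pref u i k = 0"
      using le[of j] le[of k] by auto
  qed
qed


section \<open>The buffer chain and its stability\<close>

text \<open>Sample paths \<open>v = (v\<^sub>0, v\<^sub>1, \<dots>)\<close> of an i.i.d. sequence with law \<open>\<mu>\<close>.\<close>

definition arrivals :: "'v pmf \<Rightarrow> (nat \<Rightarrow> 'v) measure" where
  "arrivals \<mu> = (\<Pi>\<^sub>M n\<in>UNIV. measure_pmf \<mu>)"

primrec buffer ::
  "'v ugraph \<Rightarrow> ('v \<Rightarrow> 'v rel) \<Rightarrow> ('v \<Rightarrow> nat) \<Rightarrow> (nat \<Rightarrow> 'v) \<Rightarrow> nat \<Rightarrow> ('v \<Rightarrow> nat)"
where
  "buffer G pref u v 0 = u"
| "buffer G pref u v (Suc n) = priority_step G pref (buffer G pref u v n) (v n)"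

text \<open>The value is \<open>\<infinity>\<close> if the path never returns, since the infimum of the empty set is \<open>\<infinity>\<close>.\<close>

definition return_time :: "(nat \<Rightarrow> 's) \<Rightarrow> 's \<Rightarrow> ennreal" where
  "return_time X x = (INF n\<in>{n. n > 0 \<and> X n = x}. of_nat n)"

definition mean_return_time ::
  "'v ugraph \<Rightarrow> ('v \<Rightarrow> 'v rel) \<Rightarrow> 'v pmf \<Rightarrow> ('v \<Rightarrow> nat) \<Rightarrow> ennreal" where
  "mean_return_time G pref \<mu> u = (\<integral>\<^sup>+ v. return_time (buffer G pref u v) u \<partial>arrivals \<mu>)"

text \<open>Positive recurrence of a Markov chain: for each state, the mean return time of the chain
  started there is finite. The model itself starts from \<open>\<lambda>_. 0\<close>; under a law charging
  every vertex, all of \<open>buffer_states G\<close> can be reached from it (let the items of the target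
  state arrive in any order), so no state has to be discarded.\<close>

definition stable :: "'v ugraph \<Rightarrow> ('v \<Rightarrow> 'v rel) \<Rightarrow> 'v pmf \<Rightarrow> bool" where
  "stable G pref \<mu> \<longleftrightarrow> (\<forall>u\<in>buffer_states G. mean_return_time G pref \<mu> u < \<infinity>)"


section \<open>A triangle with a pendant vertex\<close>

definition paw :: "nat ugraph" where
  "paw = \<lparr>verts = {1, 2, 3, 4}, edges = {{1, 2}, {2, 3}, {2, 4}, {3, 4}}\<rparr>"

lemma simple_graph_paw: "simple_graph paw"
  by (auto simp: simple_graph_def paw_def)

definition symmetric_laws :: "nat pmf set" where
  "symmetric_laws = {\<mu> \<in> full_support_laws (verts paw). pmf \<mu> 3 = pmf \<mu> 4}"

definition Ncond_laws :: "nat pmf set" where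
  "Ncond_laws = {\<mu> \<in> symmetric_laws. Ncond paw \<mu>}"

definition Stab :: "(nat \<Rightarrow> nat rel) \<Rightarrow> nat pmf set" where
  "Stab pref = {\<mu> \<in> symmetric_laws. stable paw pref \<mu>}"

definition policy_A :: "(nat \<Rightarrow> nat rel) \<Rightarrow> bool" where
  "policy_A pref \<longleftrightarrow> preferences paw pref \<and> (1, 3) \<in> pref 2 \<and> (1, 4) \<in> pref 2"

definition policy_B :: "(nat \<Rightarrow> nat rel) \<Rightarrow> bool" where
  "policy_B pref \<longleftrightarrow> preferences paw pref \<and> (3, 1) \<in> pref 2 \<and> (4, 1) \<in> pref 2"

end

theory Submission
  imports Defs
begin

text \<open>Stability follows from a Foster-Lyapunov function and is refuted by a nonnegative function
  of bounded decrease that vanishes at the empty state and has nonnegative drift elsewhere. Write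
  \<open>a = \<mu> 1\<close>, \<open>p = \<mu> 2\<close>, \<open>q = \<mu> 3 = \<mu> 4\<close>, and let \<open>x\<close>, \<open>k\<close>, \<open>y\<close> be the numbers of items of class
  \<open>1\<close>, of class \<open>2\<close>, and of classes \<open>3\<close> and \<open>4\<close> together. Under either policy the drift \<open>2 p - 1\<close>
  of \<open>k\<close> forces \<open>p < 1 / 2\<close>. Under policy \<open>A\<close> the function \<open>x + c y\<close> has drift \<open>a - c p\<close> for
  \<open>y > 0\<close> and \<open>a - p + 2 q c\<close> for \<open>y = 0\<close>; a weight \<open>c\<close> making both negative exists iff
  \<open>a (p + 2 q) < p\<^sup>2\<close>. Under policy \<open>B\<close> the number \<open>x\<close> has drift \<open>a - p\<close> whenever it is positive,
  which forces \<open>a < p\<close>; conversely, \<open>x\<close> plus a small multiple of \<open>y (y + 1) / 2\<close> plus a bounded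
  correction is a Lyapunov function.\<close>

section \<open>Mean hitting times of chains driven by i.i.d. variables\<close>

primrec driven :: "('s \<Rightarrow> 'v \<Rightarrow> 's) \<Rightarrow> 's \<Rightarrow> (nat \<Rightarrow> 'v) \<Rightarrow> nat \<Rightarrow> 's" where
  "driven \<phi> x v 0 = x"
| "driven \<phi> x v (Suc n) = \<phi> (driven \<phi> x v n) (v n)"

lemma driven_shift: "driven \<phi> x v (Suc n) = driven \<phi> (\<phi> x (v 0)) (\<lambda>k. v (Suc k)) n"
  by (induction n) auto

lemma buffer_eq_driven: "buffer G pref u v = driven (priority_step G pref) u v"
proof
  show "buffer G pref u v n = driven (priority_step G pref) u v n" for n
    by (induction n) auto
qed

definition hitting_time :: "(nat \<Rightarrow> 's) \<Rightarrow> 's \<Rightarrow> ennreal" where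
  "hitting_time X w = (INF n\<in>{n. X n = w}. of_nat n)"

lemma hitting_time_shift:
  "hitting_time X w = (if X 0 = w then 0 else 1 + hitting_time (\<lambda>n. X (Suc n)) w)"
  and return_time_shift: "return_time X w = 1 + hitting_time (\<lambda>n. X (Suc n)) w"
proof -
  let ?S = "{n. X (Suc n) = w}"
  \<comment> \<open>Padding with \<open>top\<close> gives an infimum over all naturals, through
    which \<open>1 +\<close> passes even if the state is never hit.\<close>
  have INF_restrict: "(INF n\<in>A. g n) = (INF n. if n \<in> A then g n else top)"
    for A and g :: "nat \<Rightarrow> ennreal"
  proof (intro antisym INF_greatest)
    show "(INF n\<in>A. g n) \<le> (if n \<in> A then g n else top)" for n
      by (auto intro: INF_lower)
    show "(INF n. if n \<in> A then g n else top) \<le> g n" if "n \<in> A" for n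
      using that by (intro INF_lower2[of n]) auto
  qed
  have "1 + hitting_time (\<lambda>n. X (Suc n)) w = (INF n\<in>?S. 1 + of_nat n)"
    unfolding hitting_time_def INF_restrict[of _ ?S] INF_ennreal_const_add[symmetric]
    by (rule arg_cong[where f = Inf]) auto
  then have *: "1 + hitting_time (\<lambda>n. X (Suc n)) w = (INF n\<in>Suc ` ?S. of_nat n)"
    by (simp add: image_image)
  have "{n. n > 0 \<and> X n = w} = Suc ` ?S"
    by (auto simp: image_iff gr0_conv_Suc)
  then show "return_time X w = 1 + hitting_time (\<lambda>n. X (Suc n)) w"
    unfolding return_time_def * by simp
  show "hitting_time X w = (if X 0 = w then 0 else 1 + hitting_time (\<lambda>n. X (Suc n)) w)"
  proof (cases "X 0 = w")
    case True
    then have "hitting_time X w \<le> of_nat 0"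
      unfolding hitting_time_def by (intro INF_lower) simp
    then show ?thesis using True by simp
  next
    case False
    then have "{n. X n = w} = Suc ` ?S"
      by (auto simp: image_iff) (metis not0_implies_Suc)
    then show ?thesis using False unfolding * by (simp add: hitting_time_def)
  qed
qed

section \<open>Measurability and truncated hitting times\<close>

lemma measurable_nth:
  "(\<lambda>v. v k) \<in> measurable (\<Pi>\<^sub>M n\<in>UNIV. measure_pmf \<mu>) (count_space UNIV)"
  using measurable_component_singleton[of k UNIV "\<lambda>_. measure_pmf \<mu>"]
  by (simp cong: measurable_cong_sets)

lemma measurable_shift:
  "(\<lambda>v k. v (Suc k)) \<in>
      measurable (\<Pi>\<^sub>M n\<in>UNIV. measure_pmf \<mu>) (\<Pi>\<^sub>M n\<in>UNIV. measure_pmf \<mu>)"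
  by (rule measurable_PiM_single') (auto simp: space_PiM measurable_nth)

context
  fixes \<phi> :: "'s \<Rightarrow> 'v::countable \<Rightarrow> 's" and w :: 's
begin

text \<open>The hitting time of \<open>w\<close> truncated at \<open>n\<close>, unfolded along the
  first arrival. Induction on \<open>n\<close> with arbitrary start gives measurability and integral
  bounds without a sigma-algebra on the states.\<close>

primrec capped_hitting_time :: "nat \<Rightarrow> 's \<Rightarrow> (nat \<Rightarrow> 'v) \<Rightarrow> ennreal" where
  "capped_hitting_time 0 x v = 0"
| "capped_hitting_time (Suc n) x v =
     (if x = w then 0 else 1 + capped_hitting_time n (\<phi> x (v 0)) (\<lambda>k. v (Suc k)))"

lemma capped_hitting_time_eq:
  "capped_hitting_time n x v = inf (hitting_time (driven \<phi> x v) w) (of_nat n)"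
proof (induction n arbitrary: x v)
  case (Suc n)
  show ?case
    using Suc[of "\<phi> x (v 0)" "\<lambda>k. v (Suc k)"]
    by (subst hitting_time_shift)
      (auto simp: driven_shift inf_min min_of_mono[symmetric] mono_def add_left_mono
        simp del: driven.simps(2))
qed (simp add: inf_min)

lemma hitting_time_eq_SUP:
  "hitting_time (driven \<phi> x v) w = (SUP n. capped_hitting_time n x v)"
  unfolding capped_hitting_time_eq
  by (simp add: inf_SUP[symmetric] ennreal_SUP_of_nat_eq_top)

lemma incseq_capped_hitting_time: "incseq (\<lambda>n. capped_hitting_time n x)"
  by (intro monoI le_funI) (auto simp: capped_hitting_time_eq intro!: le_infI2 of_nat_mono)

lemma measurable_capped_hitting_time [measurable]:
  "capped_hitting_time n x \<in> borel_measurable (\<Pi>\<^sub>M n\<in>UNIV. measure_pmf \<mu>)"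
proof (induction n arbitrary: x)
  case (Suc n)
  note Suc[measurable] measurable_nth[measurable] measurable_shift[measurable]
  \<comment> \<open>The first arrival takes countably many values, so it may be held fixed when
    checking measurability.\<close>
  have "(\<lambda>v. capped_hitting_time n (\<phi> x (v 0)) (\<lambda>k. v (Suc k)))
      \<in> borel_measurable (\<Pi>\<^sub>M n\<in>UNIV. measure_pmf \<mu>)"
    by (rule measurable_compose_countable[where g = "\<lambda>v. v 0"]) measurable
  then show ?case by simp
qed (simp add: capped_hitting_time.simps(1)[abs_def])

definition mean_hitting_time :: "'v pmf \<Rightarrow> 's \<Rightarrow> ennreal" where
  "mean_hitting_time \<mu> x = (\<integral>\<^sup>+ v. hitting_time (driven \<phi> x v) w \<partial>arrivals \<mu>)"

text \<open>The law of the sequence is the image, under prepending, of the product of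
  \<open>\<mu>\<close> with that same law, so Fubini separates the first arrival from the shifted
  sequence.\<close>

lemma nn_integral_arrivals_split:
  fixes \<mu> :: "'v pmf"
  assumes "\<And>i. F i \<in> borel_measurable (arrivals \<mu>)"
  shows "(\<integral>\<^sup>+ v. F (v 0) (\<lambda>k. v (Suc k)) \<partial>arrivals \<mu>)
    = (\<integral>\<^sup>+ i. \<integral>\<^sup>+ v. F i v \<partial>arrivals \<mu> \<partial>measure_pmf \<mu>)"
proof -
  interpret sequence_space "measure_pmf \<mu>" ..
  note assms[unfolded arrivals_def, measurable] measurable_nth[measurable] measurable_shift[measurable]
  have m1: "(\<lambda>v. F (v 0) (\<lambda>k. v (Suc k))) \<in> borel_measurable S"
    by (rule measurable_compose_countable[where g = "\<lambda>v. v 0"]) measurable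
  have m2: "(\<lambda>(i, v). F i v) \<in> borel_measurable (measure_pmf \<mu> \<Otimes>\<^sub>M S)"
    unfolding split_beta'
    by (rule measurable_compose_countable[where g = fst]) measurable
  have "(\<integral>\<^sup>+ v. F (v 0) (\<lambda>k. v (Suc k)) \<partial>S)
      = (\<integral>\<^sup>+ v. F (v 0) (\<lambda>k. v (Suc k)) \<partial>distr (measure_pmf \<mu> \<Otimes>\<^sub>M S) S (\<lambda>(s, \<omega>). case_nat s \<omega>))"
    by (simp add: PiM_iter)
  also have "\<dots> = (\<integral>\<^sup>+ z. (case z of (i, v) \<Rightarrow> F i v) \<partial>(measure_pmf \<mu> \<Otimes>\<^sub>M S))"
    by (subst nn_integral_distr) (use m1 in \<open>auto simp: split_beta'\<close>)
  also have "\<dots> = (\<integral>\<^sup>+ i. \<integral>\<^sup>+ v. F i v \<partial>S \<partial>measure_pmf \<mu>)"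
    using P.nn_integral_fst[OF m2] by simp
  finally show ?thesis unfolding arrivals_def .
qed

lemma emeasure_space_arrivals: "emeasure (arrivals \<mu>) (space (arrivals \<mu>)) = 1"
proof -
  interpret sequence_space "measure_pmf \<mu>" ..
  show ?thesis unfolding arrivals_def by (rule P.emeasure_space_1)
qed

lemma nn_integral_capped_hitting_time_Suc:
  assumes "x \<noteq> w"
  shows "(\<integral>\<^sup>+ v. capped_hitting_time (Suc n) x v \<partial>arrivals \<mu>)
    = 1 + (\<integral>\<^sup>+ i. \<integral>\<^sup>+ v. capped_hitting_time n (\<phi> x i) v \<partial>arrivals \<mu> \<partial>measure_pmf \<mu>)"
proof -
  have "(\<integral>\<^sup>+ v. capped_hitting_time (Suc n) x v \<partial>arrivals \<mu>)
    = (\<integral>\<^sup>+ i. \<integral>\<^sup>+ v. 1 + capped_hitting_time n (\<phi> x i) v \<partial>arrivals \<mu> \<partial>measure_pmf \<mu>)"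
    using assms nn_integral_arrivals_split[of "\<lambda>i v. 1 + capped_hitting_time n (\<phi> x i) v" \<mu>]
    by (simp add: arrivals_def)
  then show ?thesis
    by (simp add: nn_integral_add arrivals_def[symmetric] emeasure_space_arrivals)
      (simp add: nn_integral_add arrivals_def emeasure_space_arrivals[unfolded arrivals_def])
qed

lemma mean_hitting_time_eq_SUP:
  "mean_hitting_time \<mu> x = (SUP n. \<integral>\<^sup>+ v. capped_hitting_time n x v \<partial>arrivals \<mu>)"
  unfolding mean_hitting_time_def hitting_time_eq_SUP
  by (rule nn_integral_monotone_convergence_SUP)
    (simp_all add: incseq_capped_hitting_time arrivals_def)

lemma mean_hitting_time_step:
  assumes "x \<noteq> w"
  shows "mean_hitting_time \<mu> x = 1 + (\<integral>\<^sup>+ i. mean_hitting_time \<mu> (\<phi> x i) \<partial>measure_pmf \<mu>)"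
proof -
  have meas: "(\<lambda>v. hitting_time (driven \<phi> y v) w) \<in> borel_measurable (arrivals \<mu>)" for y
    unfolding hitting_time_eq_SUP arrivals_def by measurable
  have "mean_hitting_time \<mu> x
      = (\<integral>\<^sup>+ v. 1 + hitting_time (driven \<phi> (\<phi> x (v 0)) (\<lambda>k. v (Suc k))) w \<partial>arrivals \<mu>)"
    unfolding mean_hitting_time_def
    by (subst hitting_time_shift) (simp add: assms driven_shift del: driven.simps(2))
  also have "\<dots> = (\<integral>\<^sup>+ i. \<integral>\<^sup>+ v. 1 + hitting_time (driven \<phi> (\<phi> x i) v) w \<partial>arrivals \<mu> \<partial>measure_pmf \<mu>)"
    using nn_integral_arrivals_split[of "\<lambda>i v. 1 + hitting_time (driven \<phi> (\<phi> x i) v) w" \<mu>] meas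
    by simp
  finally show ?thesis
    using meas
    by (simp add: nn_integral_add emeasure_space_arrivals mean_hitting_time_def)
qed

lemma mean_return_time_eq:
  "(\<integral>\<^sup>+ v. return_time (driven \<phi> w v) w \<partial>arrivals \<mu>)
    = 1 + (\<integral>\<^sup>+ i. mean_hitting_time \<mu> (\<phi> w i) \<partial>measure_pmf \<mu>)"
proof -
  have meas: "(\<lambda>v. hitting_time (driven \<phi> y v) w) \<in> borel_measurable (arrivals \<mu>)" for y
    unfolding hitting_time_eq_SUP arrivals_def by measurable
  have "(\<integral>\<^sup>+ v. return_time (driven \<phi> w v) w \<partial>arrivals \<mu>)
      = (\<integral>\<^sup>+ v. 1 + hitting_time (driven \<phi> (\<phi> w (v 0)) (\<lambda>k. v (Suc k))) w \<partial>arrivals \<mu>)"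
    by (subst return_time_shift) (simp add: driven_shift del: driven.simps(2))
  also have "\<dots> = (\<integral>\<^sup>+ i. \<integral>\<^sup>+ v. 1 + hitting_time (driven \<phi> (\<phi> w i) v) w \<partial>arrivals \<mu> \<partial>measure_pmf \<mu>)"
    using nn_integral_arrivals_split[of "\<lambda>i v. 1 + hitting_time (driven \<phi> (\<phi> w i) v) w" \<mu>] meas
    by simp
  finally show ?thesis
    using meas
    by (simp add: nn_integral_add emeasure_space_arrivals mean_hitting_time_def)
qed

text \<open>The truncated means start at 0 and satisfy the first-step equation, so induction on
  \<open>n\<close> keeps them below any supersolution \<open>W\<close>; their supremum is the mean
  hitting time.\<close>

lemma mean_hitting_time_minimal:
  assumes step: "\<And>x i. x \<in> S \<Longrightarrow> i \<in> set_pmf \<mu> \<Longrightarrow> \<phi> x i \<in> S"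
    and drift: "\<And>x. x \<in> S \<Longrightarrow> x \<noteq> w \<Longrightarrow> 1 + (\<integral>\<^sup>+ i. W (\<phi> x i) \<partial>measure_pmf \<mu>) \<le> W x"
    and x: "x \<in> S"
  shows "mean_hitting_time \<mu> x \<le> W x"
proof -
  have "(\<integral>\<^sup>+ v. capped_hitting_time n x v \<partial>arrivals \<mu>) \<le> W x" for n
    using x
  proof (induction n arbitrary: x)
    case (Suc n)
    show ?case
    proof (cases "x = w")
      case False
      have "(\<integral>\<^sup>+ i. \<integral>\<^sup>+ v. capped_hitting_time n (\<phi> x i) v \<partial>arrivals \<mu> \<partial>measure_pmf \<mu>)
          \<le> (\<integral>\<^sup>+ i. W (\<phi> x i) \<partial>measure_pmf \<mu>)"
        using Suc step by (intro nn_integral_mono_AE) (auto simp: AE_measure_pmf_iff)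
      then show ?thesis
        using drift[OF Suc.prems False]
        unfolding nn_integral_capped_hitting_time_Suc[OF False]
        by (meson add_left_mono order.trans)
    qed simp
  qed (simp add: capped_hitting_time.simps(1)[abs_def])
  then show ?thesis
    unfolding mean_hitting_time_eq_SUP by (rule SUP_least)
qed

text \<open>Since \<open>f\<close> loses at most 1 per step, every path from \<open>x\<close> to
  \<open>w\<close> takes at least \<open>f x\<close> steps.\<close>

lemma mean_hitting_time_ge:
  fixes f :: "'s \<Rightarrow> real"
  assumes step: "\<And>x i. x \<in> S \<Longrightarrow> i \<in> set_pmf \<mu> \<Longrightarrow> \<phi> x i \<in> S"
    and dec: "\<And>x i. x \<in> S \<Longrightarrow> i \<in> set_pmf \<mu> \<Longrightarrow> f x - 1 \<le> f (\<phi> x i)"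
    and w: "f w \<le> 0" and x: "x \<in> S"
  shows "ennreal (f x) \<le> mean_hitting_time \<mu> x"
proof -
  \<comment> \<open>A time truncated at \<open>n\<close> can only dominate \<open>f\<close> capped
    at \<open>n\<close>.\<close>
  have "ennreal (min (real n) (f x)) \<le> (\<integral>\<^sup>+ v. capped_hitting_time n x v \<partial>arrivals \<mu>)" for n
    using x
  proof (induction n arbitrary: x)
    case 0
    then show ?case by (simp add: ennreal_neg)
  next
    case (Suc n)
    show ?case
    proof (cases "x = w")
      case True
      then show ?thesis using w by (simp add: ennreal_neg)
    next
      case False
      have "ennreal (min (real n) (f x - 1))
          = (\<integral>\<^sup>+ i. ennreal (min (real n) (f x - 1)) \<partial>measure_pmf \<mu>)"
        by simp
      also have "\<dots> \<le> (\<integral>\<^sup>+ i. \<integral>\<^sup>+ v. capped_hitting_time n (\<phi> x i) v \<partial>arrivals \<mu> \<partial>measure_pmf \<mu>)"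
      proof (intro nn_integral_mono_AE, unfold AE_measure_pmf_iff, intro ballI)
        fix i assume i: "i \<in> set_pmf \<mu>"
        have "ennreal (min (real n) (f x - 1)) \<le> ennreal (min (real n) (f (\<phi> x i)))"
          using dec[OF Suc.prems i] by (intro ennreal_leI) auto
        also note Suc.IH[OF step[OF Suc.prems i]]
        finally show "ennreal (min (real n) (f x - 1))
            \<le> (\<integral>\<^sup>+ v. capped_hitting_time n (\<phi> x i) v \<partial>arrivals \<mu>)" .
      qed
      finally have *: "1 + ennreal (min (real n) (f x - 1))
          \<le> (\<integral>\<^sup>+ v. capped_hitting_time (Suc n) x v \<partial>arrivals \<mu>)"
        unfolding nn_integral_capped_hitting_time_Suc[OF False] by (rule add_left_mono)
      have "ennreal (min (real (Suc n)) (f x)) = ennreal (1 + min (real n) (f x - 1))"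
        by (rule arg_cong[where f = ennreal]) auto
      \<comment> \<open>Negative reals become 0 under \<open>ennreal\<close>, so the inequality
        survives a negative \<open>f x - 1\<close>.\<close>
      also have "\<dots> \<le> 1 + ennreal (min (real n) (f x - 1))"
      proof (cases "min (real n) (f x - 1) \<ge> 0")
        case False
        then have "ennreal (1 + min (real n) (f x - 1)) \<le> ennreal 1"
          by (intro ennreal_leI) linarith
        then show ?thesis using False by (simp add: ennreal_neg)
      qed (simp add: ennreal_plus)
      finally show ?thesis using * by (rule order.trans)
    qed
  qed
  then have "ennreal (min (real n) (f x)) \<le> mean_hitting_time \<mu> x" for n
    unfolding mean_hitting_time_eq_SUP by (blast intro: SUP_upper2)
  moreover obtain n where "f x \<le> real n" using real_arch_simple by blast
  ultimately show ?thesis by (metis min.absorb2)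
qed

end

lemma nn_integral_pmf_eq_expectation:
  fixes g :: "'v \<Rightarrow> real"
  assumes "finite (set_pmf \<mu>)" "\<And>i. i \<in> set_pmf \<mu> \<Longrightarrow> 0 \<le> g i"
  shows "(\<integral>\<^sup>+ i. ennreal (g i) \<partial>measure_pmf \<mu>) = ennreal (measure_pmf.expectation \<mu> g)"
  using assms
  by (intro nn_integral_eq_integral integrable_measure_pmf_finite) (auto simp: AE_measure_pmf_iff)

text \<open>With \<open>h\<close> the mean hitting time, \<open>h - f\<close> satisfies the inequality of which \<open>h\<close> is the least
  solution, so \<open>h \<le> h - f\<close>.\<close>

lemma mean_hitting_time_eq_top:
  fixes \<phi> :: "'s \<Rightarrow> 'v::countable \<Rightarrow> 's" and f :: "'s \<Rightarrow> real"
  assumes fin: "finite (set_pmf \<mu>)"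
    and step: "\<And>x i. x \<in> S \<Longrightarrow> i \<in> set_pmf \<mu> \<Longrightarrow> \<phi> x i \<in> S"
    and nonneg: "\<And>x. x \<in> S \<Longrightarrow> 0 \<le> f x" and w: "f w = 0"
    and dec: "\<And>x i. x \<in> S \<Longrightarrow> i \<in> set_pmf \<mu> \<Longrightarrow> f x - L \<le> f (\<phi> x i)"
    and sub: "\<And>x. x \<in> S \<Longrightarrow> x \<noteq> w \<Longrightarrow> f x \<le> measure_pmf.expectation \<mu> (\<lambda>i. f (\<phi> x i))"
    and x: "x \<in> S" "0 < f x"
  shows "mean_hitting_time \<phi> w \<mu> x = \<infinity>"
proof -
  \<comment> \<open>Scaling brings the decrease per step down to at most 1, as
    \<open>mean_hitting_time_ge\<close> requires.\<close>
  define c where "c = 1 / max 1 L"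
  have c: "0 < c" "c * L \<le> 1"
    by (auto simp: c_def divide_simps)
  let ?h = "mean_hitting_time \<phi> w \<mu>"
  let ?f = "\<lambda>x. ennreal (c * f x)"
  \<comment> \<open>This domination makes the differences of \<open>?h\<close> and \<open>?f\<close>
    below genuine rather than cut off at 0.\<close>
  have f_le: "?f y \<le> ?h y" if "y \<in> S" for y
  proof (rule mean_hitting_time_ge[OF step _ _ that])
    fix y i assume y: "y \<in> S" "i \<in> set_pmf \<mu>"
    have "c * (f y - L) \<le> c * f (\<phi> y i)"
      using dec[OF y] c by (intro mult_left_mono) auto
    then show "c * f y - 1 \<le> c * f (\<phi> y i)"
      using c by (simp add: algebra_simps)
  qed (simp_all add: w)
  have "1 + (\<integral>\<^sup>+ i. ?h (\<phi> y i) - ?f (\<phi> y i) \<partial>measure_pmf \<mu>) \<le> ?h y - ?f y"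
    if y: "y \<in> S" "y \<noteq> w" for y
  proof -
    let ?Ph = "\<integral>\<^sup>+ i. ?h (\<phi> y i) \<partial>measure_pmf \<mu>"
    let ?Pf = "\<integral>\<^sup>+ i. ?f (\<phi> y i) \<partial>measure_pmf \<mu>"
    have Pf: "?Pf = ennreal (measure_pmf.expectation \<mu> (\<lambda>i. c * f (\<phi> y i)))"
      using y step nonneg c by (intro nn_integral_pmf_eq_expectation[OF fin]) auto
    have "?f y \<le> ?Pf"
      using sub[OF y] c unfolding Pf by (intro ennreal_leI) simp
    have le: "?Pf \<le> ?Ph"
      using y step f_le by (intro nn_integral_mono_AE) (auto simp: AE_measure_pmf_iff)
    have "(\<integral>\<^sup>+ i. ?h (\<phi> y i) - ?f (\<phi> y i) \<partial>measure_pmf \<mu>) = ?Ph - ?Pf"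
      using y step f_le Pf by (intro nn_integral_diff) (auto simp: AE_measure_pmf_iff)
    then have "1 + (\<integral>\<^sup>+ i. ?h (\<phi> y i) - ?f (\<phi> y i) \<partial>measure_pmf \<mu>) = ?h y - ?Pf"
      using le by (simp add: add_diff_eq_ennreal mean_hitting_time_step[OF y(2)])
    also have "\<dots> \<le> ?h y - ?f y"
      using \<open>?f y \<le> ?Pf\<close> by (rule ennreal_mono_minus)
    finally show ?thesis .
  qed
  then have *: "?h x \<le> ?h x - ?f x"
    by (intro mean_hitting_time_minimal[OF step _ x(1), where W = "\<lambda>x. ?h x - ?f x"]) auto
  have pos: "0 < ?f x" using x c by simp
  show ?thesis
  proof (rule ccontr)
    assume "?h x \<noteq> \<infinity>"
    then have "?h x - ?f x < ?h x"
      using pos less_le_trans[OF pos f_le[OF x(1)]] by (intro ennreal_between) (auto simp: less_top)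
    with * show False by simp
  qed
qed

section \<open>Drift criteria for priority policies\<close>

lemma mean_return_time_eq_mean_hitting_time:
  fixes G :: "'v::countable ugraph"
  shows "mean_return_time G pref \<mu> u
    = 1 + (\<integral>\<^sup>+ i. mean_hitting_time (priority_step G pref) u \<mu> (priority_step G pref u i) \<partial>measure_pmf \<mu>)"
  unfolding mean_return_time_def buffer_eq_driven by (rule mean_return_time_eq)

text \<open>By minimality \<open>W\<close> dominates the mean hitting time of \<open>u\<close>; the
  return adds one step from \<open>u\<close>, after which the expected \<open>W\<close> is a finite
  sum.\<close>

lemma mean_return_time_finite:
  fixes G :: "'v::countable ugraph" and W :: "('v \<Rightarrow> nat) \<Rightarrow> real"
  assumes G: "simple_graph G" and supp: "set_pmf \<mu> = verts G"
    and nonneg: "\<And>x. x \<in> buffer_states G \<Longrightarrow> 0 \<le> W x"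
    and drift: "\<And>x. x \<in> buffer_states G \<Longrightarrow> x \<noteq> u \<Longrightarrow>
      measure_pmf.expectation \<mu> (\<lambda>i. W (priority_step G pref x i)) \<le> W x - 1"
    and u: "u \<in> buffer_states G"
  shows "mean_return_time G pref \<mu> u < \<infinity>"
proof -
  let ?\<phi> = "priority_step G pref"
  have step: "?\<phi> x i \<in> buffer_states G" if "x \<in> buffer_states G" "i \<in> set_pmf \<mu>" for x i
    using that priority_step_in_buffer_states[OF G] supp by simp
  have fin: "finite (set_pmf \<mu>)"
    using G supp by (simp add: simple_graph_def)
  have PW: "(\<integral>\<^sup>+ i. ennreal (W (?\<phi> x i)) \<partial>measure_pmf \<mu>)
      = ennreal (measure_pmf.expectation \<mu> (\<lambda>i. W (?\<phi> x i)))" if "x \<in> buffer_states G" for x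
    using that step nonneg by (intro nn_integral_pmf_eq_expectation[OF fin]) auto
  have PW_nonneg: "0 \<le> measure_pmf.expectation \<mu> (\<lambda>i. W (?\<phi> x i))" if "x \<in> buffer_states G" for x
    using that step nonneg by (intro integral_nonneg_AE) (auto simp: AE_measure_pmf_iff)
  have le: "mean_hitting_time ?\<phi> u \<mu> x \<le> ennreal (W x)" if "x \<in> buffer_states G" for x
  proof (rule mean_hitting_time_minimal[where S = "buffer_states G" and W = "\<lambda>x. ennreal (W x)"])
    fix y assume y: "y \<in> buffer_states G" "y \<noteq> u"
    have "1 + ennreal (measure_pmf.expectation \<mu> (\<lambda>i. W (?\<phi> y i)))
        = ennreal (1 + measure_pmf.expectation \<mu> (\<lambda>i. W (?\<phi> y i)))"
      using PW_nonneg[OF y(1)] by (simp add: ennreal_plus)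
    also have "\<dots> \<le> ennreal (W y)"
      using drift[OF y] by (intro ennreal_leI) simp
    finally show "1 + (\<integral>\<^sup>+ i. ennreal (W (?\<phi> y i)) \<partial>measure_pmf \<mu>) \<le> ennreal (W y)"
      unfolding PW[OF y(1)] .
  qed (use step that in auto)
  have "(\<integral>\<^sup>+ i. mean_hitting_time ?\<phi> u \<mu> (?\<phi> u i) \<partial>measure_pmf \<mu>)
      \<le> (\<integral>\<^sup>+ i. ennreal (W (?\<phi> u i)) \<partial>measure_pmf \<mu>)"
    using u step le by (intro nn_integral_mono_AE) (auto simp: AE_measure_pmf_iff)
  also have "\<dots> < \<infinity>"
    unfolding PW[OF u] by simp
  finally show ?thesis
    unfolding mean_return_time_eq_mean_hitting_time by simp
qed

lemma pmf_mult_le_expectation: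
  fixes g :: "'v \<Rightarrow> real"
  assumes fin: "finite (set_pmf \<mu>)" and nonneg: "\<And>i. i \<in> set_pmf \<mu> \<Longrightarrow> 0 \<le> g i"
    and i: "i \<in> set_pmf \<mu>"
  shows "pmf \<mu> i * g i \<le> measure_pmf.expectation \<mu> g"
proof -
  have "measure_pmf.expectation \<mu> g = (\<Sum>i\<in>set_pmf \<mu>. g i * pmf \<mu> i)"
    by (rule integral_measure_pmf_real[OF fin]) auto
  moreover have "g i * pmf \<mu> i \<le> (\<Sum>i\<in>set_pmf \<mu>. g i * pmf \<mu> i)"
    using fin nonneg i by (intro member_le_sum) auto
  ultimately show ?thesis by (simp add: mult.commute)
qed

text \<open>A Lyapunov function for the empty state becomes one for any other target
  \<open>u\<close> by adding the bounded term \<open>C * (1 - f x)\<close>. Its drift is at most 0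
  away from \<open>u\<close>, and at the empty state it outweighs the uncontrolled growth of
  \<open>V\<close>.\<close>

lemma stable_if_unit_drift:
  fixes G :: "'v::countable ugraph" and V :: "('v \<Rightarrow> nat) \<Rightarrow> real"
  assumes G: "simple_graph G" and supp: "set_pmf \<mu> = verts G"
    and nonneg: "\<And>x. x \<in> buffer_states G \<Longrightarrow> 0 \<le> V x"
    and drift: "\<And>x. x \<in> buffer_states G \<Longrightarrow> x \<noteq> (\<lambda>_. 0) \<Longrightarrow>
      measure_pmf.expectation \<mu> (\<lambda>i. V (priority_step G pref x i)) \<le> V x - 1"
  shows "stable G pref \<mu>"
  unfolding stable_def
proof
  fix u assume u: "u \<in> buffer_states G"
  let ?\<phi> = "priority_step G pref" and ?B = "buffer_states G"
  let ?E = "measure_pmf.expectation \<mu>"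
  show "mean_return_time G pref \<mu> u < \<infinity>"
  proof (cases "u = (\<lambda>_. 0)")
    case True
    then show ?thesis
      using drift by (intro mean_return_time_finite[OF G supp nonneg _ u]) auto
  next
    case False
    define \<delta> where "\<delta> = Min (pmf \<mu> ` verts G)"
    have fin: "finite (verts G)" and ne: "verts G \<noteq> {}"
      using G supp set_pmf_not_empty[of \<mu>] by (auto simp: simple_graph_def)
    have \<delta>_le: "\<delta> \<le> pmf \<mu> i" if "i \<in> verts G" for i
      unfolding \<delta>_def using fin that by simp
    have \<delta>: "0 < \<delta>" "\<delta> \<le> 1"
    proof -
      have "\<delta> \<in> pmf \<mu> ` verts G"
        unfolding \<delta>_def using fin ne by (intro Min_in) auto
      then show "0 < \<delta>" "\<delta> \<le> 1"
        using supp by (auto simp: pmf_positive pmf_le_1)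
    qed
    define size :: "('v \<Rightarrow> nat) \<Rightarrow> nat" where "size x = (\<Sum>i\<in>verts G. x i)" for x
    \<comment> \<open>Below \<open>u\<close>, adding the missing items one by one leads to \<open>u\<close>, each step having
      probability at least \<open>\<delta>\<close>: so \<open>f\<close> bounds from below the probability to reach \<open>u\<close> before
      the empty state.\<close>
    define f where "f x = (if x \<le> u \<and> x \<noteq> (\<lambda>_. 0) then \<delta> ^ (size u - size x) else 0)" for x
    have f_nonneg: "0 \<le> f x" and f_le_1: "f x \<le> 1" for x
      using \<delta> by (auto simp: f_def power_le_one)
    have size_mono: "size x \<le> size u" if "x \<le> u" for x
      unfolding size_def using that by (intro sum_mono) (simp add: le_fun_def)
    \<comment> \<open>Stated with the power instead of \<open>f x\<close> to cover the empty state
      as well, where \<open>f\<close> is 0 by definition.\<close>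
    have f_up: "\<delta> ^ (size u - size x) \<le> ?E (\<lambda>i. f (?\<phi> x i))"
      if x: "x \<in> ?B" "x \<le> u" "x \<noteq> u" for x
    proof -
      obtain i where i: "x i < u i"
        using x by (metis antisym le_funD le_funI not_le)
      have iG: "i \<in> verts G"
        using i u by (auto simp: buffer_states_def)
      \<comment> \<open>As \<open>u\<close> contains class \<open>i\<close>, it holds nothing of
        adjacent classes, and neither does \<open>x\<close>: an arrival of class \<open>i\<close> is
        stored.\<close>
      have "x k = 0" if "adjacent G i k" for k
      proof -
        have "u i * u k = 0"
          using u that by (simp add: buffer_states_def)
        then have "u k = 0"
          using i by simp
        then show ?thesis using x(2) by (metis le_funD le_zero_eq)
      qed
      then have K: "{k \<in> neighbours G {i}. 0 < x k} = {}"
        by (auto simp: neighbours_def)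
      have step: "?\<phi> x i = x(i := x i + 1)"
        unfolding priority_step_def Let_def by (simp only: K simp_thms if_True)
      have size_step: "size (?\<phi> x i) = size x + 1"
        unfolding size_def step sum.remove[OF fin iG] by simp
      have le: "?\<phi> x i \<le> u"
        using x(2) i by (auto simp: step le_fun_def)
      have "f (?\<phi> x i) = \<delta> ^ (size u - size (?\<phi> x i))"
        using le by (auto simp: f_def step fun_eq_iff)
      moreover have "size u - size x = Suc (size u - size (?\<phi> x i))"
        using size_mono[OF le] size_step by simp
      ultimately have "\<delta> ^ (size u - size x) \<le> pmf \<mu> i * f (?\<phi> x i)"
        using \<delta>_le[OF iG] \<delta> by (simp add: mult_right_mono)
      also have "\<dots> \<le> ?E (\<lambda>i. f (?\<phi> x i))"
        using fin supp iG f_nonneg by (intro pmf_mult_le_expectation) auto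
      finally show ?thesis .
    qed
    have f_drift: "f x \<le> ?E (\<lambda>i. f (?\<phi> x i))" if "x \<in> ?B" "x \<noteq> u" for x
    proof (cases "x \<le> u \<and> x \<noteq> (\<lambda>_. 0)")
      case True
      then show ?thesis using f_up that by (simp add: f_def)
    next
      case False
      then show ?thesis
        using f_nonneg by (auto simp: f_def intro!: integral_nonneg_AE)
    qed
    let ?PV0 = "?E (\<lambda>i. V (?\<phi> (\<lambda>_. 0) i))"
    \<comment> \<open>At the empty state \<open>f\<close> rises on average by at least
      \<open>\<delta> ^ size u\<close>; this \<open>C\<close> makes that gain absorb
      \<open>?PV0\<close> and leave drift at most \<open>-1\<close>.\<close>
    define C where "C = (\<bar>?PV0\<bar> + 1) / \<delta> ^ size u"
    have C: "0 \<le> C"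
      using \<delta> by (simp add: C_def)
    have zero: "(\<lambda>_. 0) \<in> ?B"
      by (simp add: buffer_states_def)
    have int: "integrable (measure_pmf \<mu>) g" for g :: "'v \<Rightarrow> real"
      using fin supp by (intro integrable_measure_pmf_finite) simp
    have E_split: "?E (\<lambda>i. V (?\<phi> x i) + C * (1 - f (?\<phi> x i)))
        = ?E (\<lambda>i. V (?\<phi> x i)) + C * (1 - ?E (\<lambda>i. f (?\<phi> x i)))" for x
      by (simp add: int)
    show ?thesis
    proof (rule mean_return_time_finite[OF G supp _ _ u])
      show "0 \<le> V x + C * (1 - f x)" if "x \<in> ?B" for x
        using nonneg[OF that] C f_le_1[of x] by simp
      fix x assume x: "x \<in> ?B" "x \<noteq> u"
      show "?E (\<lambda>i. V (?\<phi> x i) + C * (1 - f (?\<phi> x i))) \<le> V x + C * (1 - f x) - 1"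
      proof (cases "x = (\<lambda>_. 0)")
        case True
        have "\<delta> ^ size u \<le> ?E (\<lambda>i. f (?\<phi> x i))"
          using f_up[OF x(1)] x(2) unfolding True by (simp add: le_fun_def size_def)
        then have "C * \<delta> ^ size u \<le> C * ?E (\<lambda>i. f (?\<phi> x i))"
          using C by (rule mult_left_mono)
        moreover have "C * \<delta> ^ size u = \<bar>?PV0\<bar> + 1"
          using \<delta> by (simp add: C_def)
        ultimately show ?thesis
          using nonneg[OF zero] unfolding E_split True by (simp add: f_def algebra_simps)
      next
        case False
        have "C * f x \<le> C * ?E (\<lambda>i. f (?\<phi> x i))"
          using f_drift[OF x] C by (rule mult_left_mono)
        then show ?thesis
          using drift[OF x(1) False] unfolding E_split by (simp add: algebra_simps)
      qed
    qed
  qed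
qed

lemma stable_if_drift:
  fixes G :: "'v::countable ugraph" and V :: "('v \<Rightarrow> nat) \<Rightarrow> real"
  assumes G: "simple_graph G" and supp: "set_pmf \<mu> = verts G" and \<epsilon>: "0 < \<epsilon>"
    and nonneg: "\<And>x. x \<in> buffer_states G \<Longrightarrow> 0 \<le> V x"
    and drift: "\<And>x. x \<in> buffer_states G \<Longrightarrow> x \<noteq> (\<lambda>_. 0) \<Longrightarrow>
      measure_pmf.expectation \<mu> (\<lambda>i. V (priority_step G pref x i)) \<le> V x - \<epsilon>"
  shows "stable G pref \<mu>"
proof (rule stable_if_unit_drift[OF G supp, where V = "\<lambda>x. V x / \<epsilon>"])
  fix x assume "x \<in> buffer_states G" "x \<noteq> (\<lambda>_. 0)"
  from divide_right_mono[OF drift[OF this], of \<epsilon>] \<epsilon>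
  show "measure_pmf.expectation \<mu> (\<lambda>i. V (priority_step G pref x i) / \<epsilon>) \<le> V x / \<epsilon> - 1"
    by (simp add: diff_divide_distrib)
qed (use nonneg \<epsilon> in simp)

text \<open>One bad first step suffices: an arrival of \<open>i\<close> has positive probability and
  leads to a state with positive \<open>f\<close>, from which the mean time back to the empty state
  is infinite.\<close>

lemma not_stable_if_drift:
  fixes G :: "'v::countable ugraph" and f :: "('v \<Rightarrow> nat) \<Rightarrow> real"
  assumes G: "simple_graph G" and supp: "set_pmf \<mu> = verts G"
    and nonneg: "\<And>x. x \<in> buffer_states G \<Longrightarrow> 0 \<le> f x" and zero: "f (\<lambda>_. 0) = 0"
    and dec: "\<And>x i. x \<in> buffer_states G \<Longrightarrow> i \<in> verts G \<Longrightarrow>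
      f x - L \<le> f (priority_step G pref x i)"
    and drift: "\<And>x. x \<in> buffer_states G \<Longrightarrow> x \<noteq> (\<lambda>_. 0) \<Longrightarrow>
      f x \<le> measure_pmf.expectation \<mu> (\<lambda>i. f (priority_step G pref x i))"
    and i: "i \<in> verts G" "0 < f ((\<lambda>_. 0)(i := 1))"
  shows "\<not> stable G pref \<mu>"
proof
  let ?\<phi> = "priority_step G pref" and ?z = "\<lambda>_. 0 :: nat"
  assume "stable G pref \<mu>"
  moreover have z: "?z \<in> buffer_states G"
    by (simp add: buffer_states_def)
  ultimately have "mean_return_time G pref \<mu> ?z < \<infinity>"
    by (simp add: stable_def)
  have step: "?\<phi> x i \<in> buffer_states G" if "x \<in> buffer_states G" "i \<in> verts G" for x i
    using that priority_step_in_buffer_states[OF G] by simp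
  have fin: "finite (set_pmf \<mu>)"
    using G supp by (simp add: simple_graph_def)
  have "?\<phi> ?z i = ?z(i := 1)"
    by (simp add: priority_step_def)
  then have "0 < f (?\<phi> ?z i)"
    using i by simp
  then have "mean_hitting_time ?\<phi> ?z \<mu> (?\<phi> ?z i) = \<infinity>"
    using nonneg zero dec drift i(1) step z
    by (intro mean_hitting_time_eq_top[OF fin, where S = "buffer_states G" and f = f and L = L])
      (auto simp: supp)
  then have "\<infinity> = mean_hitting_time ?\<phi> ?z \<mu> (?\<phi> ?z i) * ennreal (pmf \<mu> i)"
    using pmf_positive[of i \<mu>] i supp by (simp add: ennreal_top_mult)
  also have "\<dots> \<le> (\<Sum>i\<in>set_pmf \<mu>. mean_hitting_time ?\<phi> ?z \<mu> (?\<phi> ?z i) * ennreal (pmf \<mu> i))"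
    using fin i supp by (intro member_le_sum) auto
  also have "\<dots> = (\<integral>\<^sup>+ i. mean_hitting_time ?\<phi> ?z \<mu> (?\<phi> ?z i) \<partial>measure_pmf \<mu>)"
    using fin by (simp add: nn_integral_measure_pmf_finite)
  finally have "mean_return_time G pref \<mu> ?z = \<infinity>"
    unfolding mean_return_time_eq_mean_hitting_time by (simp add: top_unique)
  then show False
    using \<open>mean_return_time G pref \<mu> ?z < \<infinity>\<close> by simp
qed

text \<open>Replaces the definite description in \<open>greatest_wrt\<close> by the maximality of
  the removed class.\<close>

lemma priority_step_cases:
  assumes "simple_graph G" "preferences G pref" "i \<in> verts G"
  obtains (add) "\<And>k. k \<in> neighbours G {i} \<Longrightarrow> x k = 0" "priority_step G pref x i = x(i := x i + 1)"
  | (remove) j where "j \<in> neighbours G {i}" "0 < x j"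
      "\<And>k. k \<in> neighbours G {i} \<Longrightarrow> 0 < x k \<Longrightarrow> (k, j) \<in> pref i"
      "priority_step G pref x i = x(j := x j - 1)"
proof (cases "{k \<in> neighbours G {i}. 0 < x k} = {}")
  case True
  then have "priority_step G pref x i = x(i := x i + 1)"
    unfolding priority_step_def Let_def by (simp only: simp_thms if_True)
  then show ?thesis using True by (intro add) auto
next
  case False
  let ?K = "{k \<in> neighbours G {i}. 0 < x k}"
  have lin: "linear_order_on (neighbours G {i}) (pref i)"
    using assms by (simp add: preferences_def)
  have "finite ?K"
    using assms(1) by (auto simp: neighbours_def simple_graph_def)
  note gr = greatest_wrt[OF lin _ this False]
  have "priority_step G pref x i = x(greatest_wrt (pref i) ?K := x (greatest_wrt (pref i) ?K) - 1)"
    unfolding priority_step_def Let_def by (simp only: False if_False)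
  moreover have "greatest_wrt (pref i) ?K \<in> ?K"
    by (rule gr(1)) auto
  moreover have "(k, greatest_wrt (pref i) ?K) \<in> pref i" if "k \<in> ?K" for k
    using that by (intro gr(2)) auto
  ultimately show ?thesis by (intro remove[of "greatest_wrt (pref i) ?K"]) auto
qed

text \<open>Supplies the bounded decrease for \<open>not_stable_if_drift\<close>: a step changes one
  entry, by at most one.\<close>

lemma priority_step_ge: "x k \<le> priority_step G pref x i k + 1"
proof -
  have "x k \<le> (x(j := x j - 1)) k + 1" for j
    by (cases "k = j") auto
  moreover have "x k \<le> (x(i := x i + 1)) k + 1"
    by simp
  ultimately show ?thesis
    by (simp only: priority_step_def Let_def simp_thms split: if_split)
qed

section \<open>Steps on the triangle with a pendant vertex\<close>

\<comment> \<open>Otherwise the class \<open>1\<close> would be rewritten to \<open>Suc 0\<close>.\<close>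
declare One_nat_def [simp del]

lemma verts_paw: "verts paw = {1, 2, 3, 4}"
  by (simp add: paw_def)

lemma neighbours_paw:
  "neighbours paw {1} = {2}" "neighbours paw {2} = {1, 3, 4}"
  "neighbours paw {3} = {2, 4}" "neighbours paw {4} = {2, 3}"
  by (auto simp: neighbours_def adjacent_def paw_def doubleton_eq_iff)

lemma buffer_states_paw:
  "x \<in> buffer_states paw \<longleftrightarrow> (\<forall>i. i \<notin> {1, 2, 3, 4} \<longrightarrow> x i = 0) \<and>
    (x 2 = 0 \<or> x 1 = 0 \<and> x 3 = 0 \<and> x 4 = 0) \<and> (x 3 = 0 \<or> x 4 = 0)"
  (is "?L \<longleftrightarrow> ?R")
proof
  assume L: ?L
  have "adjacent paw 1 2" "adjacent paw 2 3" "adjacent paw 2 4" "adjacent paw 3 4"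
    by (auto simp: adjacent_def paw_def)
  then have "x 1 * x 2 = 0" "x 2 * x 3 = 0" "x 2 * x 4 = 0" "x 3 * x 4 = 0"
    using L by (simp_all only: buffer_states_def mem_Collect_eq)
  moreover have "\<forall>i. i \<notin> {1, 2, 3, 4} \<longrightarrow> x i = 0"
    using L unfolding buffer_states_def verts_paw by blast
  ultimately show ?R by auto
next
  assume ?R
  then show ?L
    by (auto simp: buffer_states_def verts_paw adjacent_def paw_def doubleton_eq_iff)
qed

lemma buffer_states_paw_eq_0:
  assumes "x \<in> buffer_states paw" "x 1 = 0" "x 2 = 0" "x 3 + x 4 = 0"
  shows "x = (\<lambda>_. 0)"
proof
  show "x i = 0" for i
    using assms by (cases "i \<in> {1, 2, 3, 4}") (auto simp: buffer_states_paw)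
qed

lemma symmetric_laws:
  assumes "\<mu> \<in> symmetric_laws"
  shows "set_pmf \<mu> = verts paw" "pmf \<mu> 4 = pmf \<mu> 3"
    "0 < pmf \<mu> 1" "0 < pmf \<mu> 2" "0 < pmf \<mu> 3" "pmf \<mu> 1 + pmf \<mu> 2 + 2 * pmf \<mu> 3 = 1"
    "measure_pmf.expectation \<mu> g = pmf \<mu> 1 * g 1 + pmf \<mu> 2 * g 2 + pmf \<mu> 3 * (g 3 + g 4)"
proof -
  show supp: "set_pmf \<mu> = verts paw" and eq: "pmf \<mu> 4 = pmf \<mu> 3"
    using assms by (auto simp: symmetric_laws_def full_support_laws_def)
  show "0 < pmf \<mu> 1" "0 < pmf \<mu> 2" "0 < pmf \<mu> 3"
    using supp by (simp_all add: pmf_positive verts_paw)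
  have "(\<Sum>i\<in>{1, 2, 3, 4}. pmf \<mu> i) = 1"
    using supp by (intro sum_pmf_eq_1) (auto simp: verts_paw)
  then show "pmf \<mu> 1 + pmf \<mu> 2 + 2 * pmf \<mu> 3 = 1"
    using eq by simp
  have "measure_pmf.expectation \<mu> g = (\<Sum>i\<in>{1, 2, 3, 4}. g i * pmf \<mu> i)"
    using supp by (intro integral_measure_pmf_real) (auto simp: verts_paw)
  then show "measure_pmf.expectation \<mu> g = pmf \<mu> 1 * g 1 + pmf \<mu> 2 * g 2 + pmf \<mu> 3 * (g 3 + g 4)"
    using eq by (simp add: algebra_simps)
qed

text \<open>The independent sets are the singletons, \<open>{1, 3}\<close> and
  \<open>{1, 4}\<close>. Only \<open>{1}\<close> and \<open>{2}\<close> impose conditions, the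
  latter because the neighbours of 2 have mass \<open>1 - pmf \<mu> 2\<close>. For
  \<open>{3}\<close> and \<open>{4}\<close> the inequality is automatic, and for the pairs the equal
  weights of 3 and 4 cancel.\<close>

lemma Ncond_paw_iff:
  assumes "\<mu> \<in> symmetric_laws"
  shows "Ncond paw \<mu> \<longleftrightarrow> pmf \<mu> 1 < pmf \<mu> 2 \<and> pmf \<mu> 2 < 1 / 2"
proof
  note \<mu> = symmetric_laws[OF assms]
  {
    assume N: "Ncond paw \<mu>"
    have "independent_vertices paw {1}" "independent_vertices paw {2}"
      by (auto simp: independent_vertices_def paw_def adjacent_def)
    then have "measure \<mu> {1} < measure \<mu> (neighbours paw {1})"
      "measure \<mu> {2} < measure \<mu> (neighbours paw {2})"
      using N by (auto simp: Ncond_def)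
    then show "pmf \<mu> 1 < pmf \<mu> 2 \<and> pmf \<mu> 2 < 1 / 2"
      using \<mu>(2,6) by (simp add: neighbours_paw measure_measure_pmf_finite)
  }
  assume less: "pmf \<mu> 1 < pmf \<mu> 2 \<and> pmf \<mu> 2 < 1 / 2"
  show "Ncond paw \<mu>"
    unfolding Ncond_def
  proof (intro allI impI)
    fix I assume I: "independent_vertices paw I"
    have adj: "\<not> (i \<in> I \<and> j \<in> I)" if "{i, j} \<in> edges paw" for i j
      using I that unfolding independent_vertices_def adjacent_def by blast
    have notin: "\<not> (1 \<in> I \<and> 2 \<in> I)" "\<not> (2 \<in> I \<and> 3 \<in> I)" "\<not> (2 \<in> I \<and> 4 \<in> I)"
      "\<not> (3 \<in> I \<and> 4 \<in> I)"
      by (rule adj; simp add: paw_def)+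
    have "I \<subseteq> {1, 2, 3, 4}" and ne: "I \<noteq> {}"
      using I unfolding independent_vertices_def verts_paw by blast+
    then have I_eq: "I = (if 1 \<in> I then {1} else {}) \<union> (if 2 \<in> I then {2} else {})
        \<union> (if 3 \<in> I then {3} else {}) \<union> (if 4 \<in> I then {4} else {})"
      by auto
    consider "I = {1}" | "I = {2}" | "I = {3}" | "I = {4}" | "I = {1, 3}" | "I = {1, 4}"
      using I_eq ne notin
      by (cases "1 \<in> I"; cases "2 \<in> I"; cases "3 \<in> I"; cases "4 \<in> I") (simp_all add: insert_commute)
    moreover have "neighbours paw {1, 3} = {2, 4}" "neighbours paw {1, 4} = {2, 3}"
      by (auto simp: neighbours_def adjacent_def paw_def doubleton_eq_iff)
    ultimately show "measure \<mu> I < measure \<mu> (neighbours paw I)"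
      using less \<mu>(2-6)
      by cases (simp_all add: neighbours_paw measure_measure_pmf_finite)
  qed
qed

section \<open>Transitions of the paw from a fixed state, then expectations after one step\<close>

context
  fixes pref :: "nat \<Rightarrow> nat rel" and x :: "nat \<Rightarrow> nat"
  assumes pref: "preferences paw pref" and x: "x \<in> buffer_states paw"
begin

lemma paw_step_2_present:
  assumes "0 < x 2"
  shows "i \<in> {1, 3, 4} \<Longrightarrow> priority_step paw pref x i = x(2 := x 2 - 1)"
    "priority_step paw pref x 2 = x(2 := x 2 + 1)"
proof -
  have z: "x 1 = 0" "x 3 = 0" "x 4 = 0"
    using assms x by (auto simp: buffer_states_paw)
  show "priority_step paw pref x i = x(2 := x 2 - 1)" if "i \<in> {1, 3, 4}"
    using that assms z
    by (cases rule: priority_step_cases[OF simple_graph_paw pref, of i x])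
      (auto simp: verts_paw neighbours_paw)
  show "priority_step paw pref x 2 = x(2 := x 2 + 1)"
    using assms z
    by (cases rule: priority_step_cases[OF simple_graph_paw pref, of 2 x])
      (auto simp: verts_paw neighbours_paw)
qed

lemma paw_step_1:
  assumes "x 2 = 0"
  shows "priority_step paw pref x 1 = x(1 := x 1 + 1)"
  using assms
  by (cases rule: priority_step_cases[OF simple_graph_paw pref, of 1 x])
    (auto simp: verts_paw neighbours_paw)

lemma paw_step_2_only_1:
  assumes "x 3 + x 4 = 0" "0 < x 1"
  shows "priority_step paw pref x 2 = x(1 := x 1 - 1)"
  using assms
  by (cases rule: priority_step_cases[OF simple_graph_paw pref, of 2 x])
    (auto simp: verts_paw neighbours_paw)

lemma paw_step_34:
  assumes "x 2 = 0" "0 < x 3"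
  shows "priority_step paw pref x 3 = x(3 := x 3 + 1)"
    "priority_step paw pref x 4 = x(3 := x 3 - 1)"
proof -
  have "x 4 = 0"
    using assms x by (auto simp: buffer_states_paw)
  then show "priority_step paw pref x 3 = x(3 := x 3 + 1)"
    using assms
    by (cases rule: priority_step_cases[OF simple_graph_paw pref, of 3 x])
      (auto simp: verts_paw neighbours_paw)
  show "priority_step paw pref x 4 = x(3 := x 3 - 1)"
    using assms
    by (cases rule: priority_step_cases[OF simple_graph_paw pref, of 4 x])
      (auto simp: verts_paw neighbours_paw)
qed

lemma paw_step_43:
  assumes "x 2 = 0" "0 < x 4"
  shows "priority_step paw pref x 4 = x(4 := x 4 + 1)"
    "priority_step paw pref x 3 = x(4 := x 4 - 1)"
proof -
  have "x 3 = 0"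
    using assms x by (auto simp: buffer_states_paw)
  then show "priority_step paw pref x 4 = x(4 := x 4 + 1)"
    using assms
    by (cases rule: priority_step_cases[OF simple_graph_paw pref, of 4 x])
      (auto simp: verts_paw neighbours_paw)
  show "priority_step paw pref x 3 = x(4 := x 4 - 1)"
    using assms
    by (cases rule: priority_step_cases[OF simple_graph_paw pref, of 3 x])
      (auto simp: verts_paw neighbours_paw)
qed

lemma paw_step_34_empty:
  assumes "x 2 = 0" "x 3 + x 4 = 0" "i \<in> {3, 4}"
  shows "priority_step paw pref x i = x(i := x i + 1)"
  using assms
  by (cases rule: priority_step_cases[OF simple_graph_paw pref, of i x])
    (auto simp: verts_paw neighbours_paw)

text \<open>The policies are given by reflexive orders; antisymmetry turns their priorities into
  strict ones.\<close>

lemma antisym_pref_2: "(i, j) \<in> pref 2 \<Longrightarrow> (j, i) \<in> pref 2 \<Longrightarrow> i = j"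
  using pref by (auto simp: preferences_def verts_paw order_on_defs dest: antisymD)

text \<open>The disjunction serves policy A in every state and policy B in states without class
  1.\<close>

lemma paw_step_2_removes_34:
  assumes "0 < x 3 + x 4" and prio: "x 1 = 0 \<or> (1, 3) \<in> pref 2 \<and> (1, 4) \<in> pref 2"
  shows "priority_step paw pref x 2 =
    (if 0 < x 3 then x(3 := x 3 - 1) else x(4 := x 4 - 1))"
proof -
  have 34: "x 3 = 0 \<or> x 4 = 0"
    using x by (auto simp: buffer_states_paw)
  show ?thesis
  proof (rule priority_step_cases[OF simple_graph_paw pref, of 2 x])
    fix j
    assume remove: "j \<in> neighbours paw {2}" "0 < x j"
      "\<And>k. k \<in> neighbours paw {2} \<Longrightarrow> 0 < x k \<Longrightarrow> (k, j) \<in> pref 2"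
      "priority_step paw pref x 2 = x(j := x j - 1)"
    have "j \<noteq> 1"
    proof
      assume "j = 1"
      then have "0 < x 3 \<Longrightarrow> (3, 1) \<in> pref 2" "0 < x 4 \<Longrightarrow> (4, 1) \<in> pref 2" "0 < x 1"
        using remove by (simp_all add: neighbours_paw)
      then show False
        using assms antisym_pref_2[of 1 3] antisym_pref_2[of 1 4] by auto
    qed
    then have "j = 3 \<or> j = 4"
      using remove(1) by (simp add: neighbours_paw)
    then show ?thesis using remove(2,4) 34 by auto
  qed (use assms(1) in \<open>auto simp: verts_paw neighbours_paw\<close>)
qed

lemma paw_step_2_removes_1:
  assumes "0 < x 1" and prio: "(3, 1) \<in> pref 2" "(4, 1) \<in> pref 2"
  shows "priority_step paw pref x 2 = x(1 := x 1 - 1)"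
proof (rule priority_step_cases[OF simple_graph_paw pref, of 2 x])
  fix j
  assume remove: "j \<in> neighbours paw {2}"
    "\<And>k. k \<in> neighbours paw {2} \<Longrightarrow> 0 < x k \<Longrightarrow> (k, j) \<in> pref 2"
    "priority_step paw pref x 2 = x(j := x j - 1)"
  have "(1, j) \<in> pref 2"
    using remove(2)[of 1] assms(1) by (simp add: neighbours_paw)
  then have "j = 1"
    using remove(1) prio antisym_pref_2[of 1 j] by (auto simp: neighbours_paw)
  then show ?thesis using remove(3) by simp
qed (use assms(1) in \<open>auto simp: verts_paw neighbours_paw\<close>)

text \<open>A law with equal weights at \<open>3\<close> and \<open>4\<close> only sees a state through its numbers of items
  of class \<open>1\<close>, of class \<open>2\<close>, and of classes \<open>3\<close> and \<open>4\<close> together.\<close>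

context
  fixes \<mu> :: "nat pmf" and V :: "(nat \<Rightarrow> nat) \<Rightarrow> real" and F :: "nat \<Rightarrow> nat \<Rightarrow> nat \<Rightarrow> real"
  assumes \<mu>: "\<mu> \<in> symmetric_laws" and V: "\<And>x. V x = F (x 1) (x 2) (x 3 + x 4)"
begin

lemma paw_expectation_2_present:
  assumes "0 < x 2"
  shows "measure_pmf.expectation \<mu> (\<lambda>i. V (priority_step paw pref x i))
    = (1 - pmf \<mu> 2) * F 0 (x 2 - 1) 0 + pmf \<mu> 2 * F 0 (x 2 + 1) 0"
proof -
  have z: "x 1 = 0" "x 3 = 0" "x 4 = 0"
    using assms x by (auto simp: buffer_states_paw)
  have eq: "1 - pmf \<mu> 2 = pmf \<mu> 1 + 2 * pmf \<mu> 3"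
    using symmetric_laws(6)[OF \<mu>] by simp
  show ?thesis
    unfolding symmetric_laws(7)[OF \<mu>] eq using assms z
    by (simp add: V paw_step_2_present algebra_simps)
qed

lemma paw_expectation_only_1:
  assumes "0 < x 1" "x 3 + x 4 = 0"
  shows "measure_pmf.expectation \<mu> (\<lambda>i. V (priority_step paw pref x i))
    = pmf \<mu> 1 * F (x 1 + 1) 0 0 + pmf \<mu> 2 * F (x 1 - 1) 0 0 + 2 * pmf \<mu> 3 * F (x 1) 0 1"
proof -
  have z: "x 2 = 0" "x 3 = 0" "x 4 = 0"
    using assms x by (auto simp: buffer_states_paw)
  show ?thesis
    unfolding symmetric_laws(7)[OF \<mu>] using assms z
    by (simp add: V paw_step_1 paw_step_2_only_1 paw_step_34_empty)
qed

text \<open>The arrival of class 2 stays unevaluated, being the only one whose effect depends on the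
  policy. Of classes 3 and 4, the one present grows and the other one removes an item of it, with
  equal probabilities.\<close>

lemma paw_expectation_34_present:
  assumes "0 < x 3 + x 4"
  shows "measure_pmf.expectation \<mu> (\<lambda>i. V (priority_step paw pref x i))
    = pmf \<mu> 1 * F (x 1 + 1) 0 (x 3 + x 4) + pmf \<mu> 2 * V (priority_step paw pref x 2)
      + pmf \<mu> 3 * (F (x 1) 0 (x 3 + x 4 + 1) + F (x 1) 0 (x 3 + x 4 - 1))"
proof -
  have "0 < x 3 \<and> x 4 = 0 \<or> 0 < x 4 \<and> x 3 = 0" and z: "x 2 = 0"
    using assms x by (auto simp: buffer_states_paw)
  then show ?thesis
    unfolding symmetric_laws(7)[OF \<mu>]
    by (elim disjE) (auto simp: V paw_step_1 paw_step_34 paw_step_43)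
qed

lemma paw_removes_34:
  assumes "0 < x 3 + x 4" and prio: "x 1 = 0 \<or> (1, 3) \<in> pref 2 \<and> (1, 4) \<in> pref 2"
  shows "V (priority_step paw pref x 2) = F (x 1) 0 (x 3 + x 4 - 1)"
proof -
  have "0 < x 3 \<and> x 4 = 0 \<or> 0 < x 4 \<and> x 3 = 0" and z: "x 2 = 0"
    using assms x by (auto simp: buffer_states_paw)
  then show ?thesis
    using paw_step_2_removes_34[OF assms] by (auto simp: V)
qed

lemma paw_removes_1:
  assumes "0 < x 1" and prio: "(3, 1) \<in> pref 2" "(4, 1) \<in> pref 2"
  shows "V (priority_step paw pref x 2) = F (x 1 - 1) 0 (x 3 + x 4)"
proof -
  have z: "x 2 = 0"
    using assms x by (auto simp: buffer_states_paw)
  then show ?thesis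
    using paw_step_2_removes_1[OF assms] by (simp add: V)
qed

end

end

section \<open>Stability regions of the two policies\<close>

text \<open>Class 2 is alone in the buffer whenever present, and every other arrival then removes
  one of its items, whatever the preferences.\<close>

lemma stable_paw_imp_less_half:
  assumes pref: "preferences paw pref" and \<mu>: "\<mu> \<in> symmetric_laws" and stable: "stable paw pref \<mu>"
  shows "pmf \<mu> 2 < 1 / 2"
proof (rule ccontr)
  assume less: "\<not> pmf \<mu> 2 < 1 / 2"
  note law = symmetric_laws[OF \<mu>]
  have "\<not> stable paw pref \<mu>"
  proof (rule not_stable_if_drift[OF simple_graph_paw law(1), where f = "\<lambda>x. real (x 2)"
        and L = 1 and i = 2])
    fix x :: "nat \<Rightarrow> nat" assume x: "x \<in> buffer_states paw"
    show "real (x 2) - 1 \<le> real (priority_step paw pref x i 2)" for i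
      using priority_step_ge[of x 2 paw pref i] by simp
    show "real (x 2) \<le> measure_pmf.expectation \<mu> (\<lambda>i. real (priority_step paw pref x i 2))"
    proof (cases "x 2 = 0")
      case False
      then have "measure_pmf.expectation \<mu> (\<lambda>i. real (priority_step paw pref x i 2))
          = (1 - pmf \<mu> 2) * real (x 2 - 1) + pmf \<mu> 2 * real (x 2 + 1)"
        by (intro paw_expectation_2_present[OF pref x \<mu>, where F = "\<lambda>_ k _. real k"]) auto
      then show ?thesis
        using False less by (simp add: of_nat_diff algebra_simps)
    qed simp
  qed (simp_all add: verts_paw)
  then show False using stable by simp
qed

lemma paw_cases:
  assumes "x \<in> buffer_states paw" "x \<noteq> (\<lambda>_. 0)"
  obtains (2) k where "x 1 = 0" "x 2 = Suc k" "x 3 = 0" "x 4 = 0"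
  | (34) y where "x 2 = 0" "x 3 + x 4 = Suc y"
  | (1) n where "x 1 = Suc n" "x 2 = 0" "x 3 + x 4 = 0"
proof (cases "x 2")
  case 0
  show ?thesis
  proof (cases "x 3 + x 4")
    case y: 0
    then have "x 1 \<noteq> 0"
      using buffer_states_paw_eq_0[OF assms(1)] assms(2) 0 by auto
    then show ?thesis using 1 0 y by (cases "x 1") auto
  qed (use 0 34 in blast)
next
  case (Suc k)
  then show ?thesis using assms(1) 2 by (simp add: buffer_states_paw)
qed

text \<open>While \<open>x 3 + x 4\<close> is positive, arrivals of 3 and 4 cancel on average and
  class 2 removes from them; at 0 both enlarge the sum and class 2 turns to class 1. The weight
  \<open>s\<close> will be 0 for instability and 1 for stability.\<close>

lemma policy_A_linear_drift:
  fixes c s :: real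
  defines "V \<equiv> \<lambda>x. real (x 1) + c * real (x 3 + x 4) + s * real (x 2)"
  assumes pref: "policy_A pref" and \<mu>: "\<mu> \<in> symmetric_laws"
    and x: "x \<in> buffer_states paw" "x \<noteq> (\<lambda>_. 0)"
  shows "measure_pmf.expectation \<mu> (\<lambda>i. V (priority_step paw pref x i)) - V x =
    (if 0 < x 2 then s * (2 * pmf \<mu> 2 - 1)
     else if 0 < x 3 + x 4 then pmf \<mu> 1 - c * pmf \<mu> 2
     else pmf \<mu> 1 - pmf \<mu> 2 + 2 * c * pmf \<mu> 3)" (is "?E - _ = _")
proof -
  have pref': "preferences paw pref" and prio: "x 1 = 0 \<or> (1, 3) \<in> pref 2 \<and> (1, 4) \<in> pref 2"
    using pref by (auto simp: policy_A_def)
  have sum: "pmf \<mu> 1 = 1 - pmf \<mu> 2 - 2 * pmf \<mu> 3"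
    using symmetric_laws(6)[OF \<mu>] by simp
  define F :: "nat \<Rightarrow> nat \<Rightarrow> nat \<Rightarrow> real" where "F x k y = x + c * y + s * k" for x k y
  have V: "V x = F (x 1) (x 2) (x 3 + x 4)" for x
    by (simp add: V_def F_def)
  note E = paw_expectation_2_present[where V = V and F = F, OF pref' x(1) \<mu> V]
    paw_expectation_only_1[where V = V and F = F, OF pref' x(1) \<mu> V]
    paw_expectation_34_present[where V = V and F = F, OF pref' x(1) \<mu> V]
    paw_removes_34[where V = V and F = F, OF pref' x(1) \<mu> V]
  from x show ?thesis
  proof (cases rule: paw_cases)
    case (2 k)
    then have "0 < x 2" by simp
    then show ?thesis
      unfolding E(1)[OF \<open>0 < x 2\<close>] using 2 by (simp add: V F_def algebra_simps)
  next
    case (34 y)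
    then have y: "0 < x 3 + x 4" by simp
    show ?thesis
      unfolding E(3)[OF y] E(4)[OF y prio] using 34
      by (simp add: V F_def sum algebra_simps)
  next
    case (1 n)
    then have n: "0 < x 1" by simp
    show ?thesis
      unfolding E(2)[OF n 1(3)] using 1 by (simp add: V F_def sum algebra_simps)
  qed
qed

section \<open>Stability region of policy A\<close>

lemma policy_A_criterion:
  assumes "\<mu> \<in> symmetric_laws"
  shows "pmf \<mu> 1 * (1 - pmf \<mu> 1) = pmf \<mu> 1 * pmf \<mu> 2 + 2 * pmf \<mu> 1 * pmf \<mu> 3"
proof -
  have eq: "1 - pmf \<mu> 1 = pmf \<mu> 2 + 2 * pmf \<mu> 3"
    using symmetric_laws(6)[OF assms] by simp
  show ?thesis unfolding eq by (simp add: algebra_simps)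
qed

text \<open>If the inequality fails, one weight \<open>c\<close> makes the drift nonnegative in both
  regimes without class 2; giving class 2 weight 0 makes its states harmless.\<close>

lemma policy_A_stable_imp:
  assumes A: "policy_A pref" and \<mu>: "\<mu> \<in> symmetric_laws" and stable: "stable paw pref \<mu>"
  shows "pmf \<mu> 1 * (1 - pmf \<mu> 1) < (pmf \<mu> 2)\<^sup>2"
proof (rule ccontr)
  note law = symmetric_laws[OF \<mu>]
  define a p q where "a = pmf \<mu> 1" and "p = pmf \<mu> 2" and "q = pmf \<mu> 3"
  note defs = a_def[symmetric] p_def[symmetric] q_def[symmetric]
  have pos: "0 < a" "0 < p" "0 < q"
    using law(3-5) unfolding defs by auto
  assume "\<not> pmf \<mu> 1 * (1 - pmf \<mu> 1) < (pmf \<mu> 2)\<^sup>2"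
  then have ge: "p * p \<le> a * p + 2 * a * q"
    unfolding policy_A_criterion[OF \<mu>] by (simp add: defs power2_eq_square)
  \<comment> \<open>The weight \<open>a / p\<close> makes the drift vanish while items of class 3 or 4 are present.\<close>
  define c where "c = a / p"
  have c: "0 < c" "c * p = a"
    using pos by (simp_all add: c_def)
  have "0 \<le> p * (a - p + 2 * c * q)"
    using ge by (simp add: algebra_simps flip: c(2))
  then have bd: "0 \<le> a - p + 2 * c * q"
    using pos by (simp add: zero_le_mult_iff)
  have "\<not> stable paw pref \<mu>"
  proof (rule not_stable_if_drift[OF simple_graph_paw law(1), where L = "1 + 2 * c" and i = 1
        and f = "\<lambda>x. real (x 1) + c * real (x 3 + x 4) + 0 * real (x 2)"])
    fix x :: "nat \<Rightarrow> nat" assume x: "x \<in> buffer_states paw"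
    let ?\<phi> = "priority_step paw pref x"
    show "real (x 1) + c * real (x 3 + x 4) + 0 * real (x 2) - (1 + 2 * c)
        \<le> real (?\<phi> i 1) + c * real (?\<phi> i 3 + ?\<phi> i 4) + 0 * real (?\<phi> i 2)" for i
    proof -
      have "x 3 + x 4 \<le> ?\<phi> i 3 + ?\<phi> i 4 + 2"
        using priority_step_ge[of x 3 paw pref i] priority_step_ge[of x 4 paw pref i]
        by linarith
      then have "c * real (x 3 + x 4) \<le> c * real (?\<phi> i 3 + ?\<phi> i 4 + 2)"
        using c by (intro mult_left_mono) (simp_all only: of_nat_le_iff less_imp_le)
      moreover have "real (x 1) \<le> real (?\<phi> i 1 + 1)"
        using priority_step_ge[of x 1 paw pref i] by (simp only: of_nat_le_iff)
      ultimately show ?thesis by (simp add: algebra_simps)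
    qed
    assume "x \<noteq> (\<lambda>_. 0)"
    from policy_A_linear_drift[OF A \<mu> x this, of c 0]
    show "real (x 1) + c * real (x 3 + x 4) + 0 * real (x 2)
        \<le> measure_pmf.expectation \<mu>
            (\<lambda>i. real (?\<phi> i 1) + c * real (?\<phi> i 3 + ?\<phi> i 4) + 0 * real (?\<phi> i 2))"
      unfolding defs using c bd by (simp split: if_splits)
  qed (use c in \<open>simp_all add: verts_paw\<close>)
  then show False using stable by simp
qed

lemma policy_A_stable:
  assumes A: "policy_A pref" and \<mu>: "\<mu> \<in> symmetric_laws" and half: "pmf \<mu> 2 < 1 / 2"
    and less: "pmf \<mu> 1 * (1 - pmf \<mu> 1) < (pmf \<mu> 2)\<^sup>2"
  shows "stable paw pref \<mu>"
proof -
  note law = symmetric_laws[OF \<mu>]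
  define a p q where "a = pmf \<mu> 1" and "p = pmf \<mu> 2" and "q = pmf \<mu> 3"
  note defs = a_def[symmetric] p_def[symmetric] q_def[symmetric]
  have pos: "0 < a" "0 < p" "0 < q"
    using law(3-5) unfolding defs by auto
  \<comment> \<open>The lower bound on \<open>c\<close> gives negative drift with class 3 or 4
    present, the upper one with only class 1 present; the assumed inequality says that this interval
    is nonempty.\<close>
  have "a / p < (p - a) / (2 * q)"
    using less pos unfolding policy_A_criterion[OF \<mu>]
    by (simp add: defs field_simps power2_eq_square)
  then obtain c where c: "a / p < c" "c < (p - a) / (2 * q)"
    using dense by blast
  have "0 < a / p"
    using pos by simp
  then have "0 < c"
    using c by linarith
  define \<epsilon> where "\<epsilon> = min (c * p - a) (min (p - a - 2 * c * q) (1 - 2 * p))"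
  have \<epsilon>: "0 < \<epsilon>" "\<epsilon> \<le> c * p - a" "\<epsilon> \<le> p - a - 2 * c * q" "\<epsilon> \<le> 1 - 2 * p"
    using half c pos unfolding defs by (auto simp: \<epsilon>_def field_simps)
  show ?thesis
  proof (rule stable_if_drift[OF simple_graph_paw law(1) \<epsilon>(1),
        where V = "\<lambda>x. real (x 1) + c * real (x 3 + x 4) + 1 * real (x 2)"])
    show "0 \<le> real (x 1) + c * real (x 3 + x 4) + 1 * real (x 2)" for x
      using \<open>0 < c\<close> by simp
    fix x :: "nat \<Rightarrow> nat" assume x: "x \<in> buffer_states paw" "x \<noteq> (\<lambda>_. 0)"
    let ?\<phi> = "priority_step paw pref x"
    from policy_A_linear_drift[OF A \<mu> x, of c 1]
    show "measure_pmf.expectation \<mu>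
          (\<lambda>i. real (?\<phi> i 1) + c * real (?\<phi> i 3 + ?\<phi> i 4) + 1 * real (?\<phi> i 2))
        \<le> real (x 1) + c * real (x 3 + x 4) + 1 * real (x 2) - \<epsilon>"
      unfolding defs using \<epsilon> by (simp split: if_splits)
  qed
qed

section \<open>Stability region of policy B\<close>

lemma policy_B_stable_imp:
  assumes B: "policy_B pref" and \<mu>: "\<mu> \<in> symmetric_laws" and stable: "stable paw pref \<mu>"
  shows "pmf \<mu> 1 < pmf \<mu> 2"
proof (rule ccontr)
  assume ge: "\<not> pmf \<mu> 1 < pmf \<mu> 2"
  note law = symmetric_laws[OF \<mu>]
  have pref: "preferences paw pref" and prio: "(3, 1) \<in> pref 2" "(4, 1) \<in> pref 2"
    using B by (auto simp: policy_B_def)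
  have sum: "pmf \<mu> 3 = (1 - pmf \<mu> 1 - pmf \<mu> 2) / 2"
    using law(6) by simp
  have "\<not> stable paw pref \<mu>"
  proof (rule not_stable_if_drift[OF simple_graph_paw law(1), where f = "\<lambda>x. real (x 1)"
        and L = 1 and i = 1])
    fix x :: "nat \<Rightarrow> nat" assume x: "x \<in> buffer_states paw"
    let ?\<phi> = "priority_step paw pref x"
    show "real (x 1) - 1 \<le> real (?\<phi> i 1)" for i
      using priority_step_ge[of x 1 paw pref i] by simp
    show "real (x 1) \<le> measure_pmf.expectation \<mu> (\<lambda>i. real (?\<phi> i 1))"
    proof (cases "x 1")
      case (Suc n)
      define F :: "nat \<Rightarrow> nat \<Rightarrow> nat \<Rightarrow> real" where "F n k y = n" for n k y
      note E = paw_expectation_only_1[where F = F, OF pref x \<mu> refl]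
        paw_expectation_34_present[where F = F, OF pref x \<mu> refl]
        paw_removes_1[where F = F, OF pref x \<mu> refl]
      \<comment> \<open>Both cases give the same drift, since class 2 serves class 1 first even when
        class 3 or 4 is waiting.\<close>
      have "measure_pmf.expectation \<mu> (\<lambda>i. real (?\<phi> i 1)) = real (x 1) + (pmf \<mu> 1 - pmf \<mu> 2)"
      proof (cases "x 3 + x 4 = 0")
        case True
        then show ?thesis
          using E(1) Suc by (simp add: F_def sum field_simps)
      next
        case False
        then show ?thesis
          using E(2,3) Suc prio by (simp add: F_def sum field_simps)
      qed
      then show ?thesis using ge by simp
    qed simp
  qed (simp_all add: verts_paw)
  then show False using stable by simp
qed

lemma policy_B_stable:
  assumes B: "policy_B pref" and \<mu>: "\<mu> \<in> symmetric_laws"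
    and less: "pmf \<mu> 1 < pmf \<mu> 2" and half: "pmf \<mu> 2 < 1 / 2"
  shows "stable paw pref \<mu>"
proof -
  note law = symmetric_laws[OF \<mu>]
  have pref: "preferences paw pref" and prio: "(3, 1) \<in> pref 2" "(4, 1) \<in> pref 2"
    using B by (auto simp: policy_B_def)
  define a p q where "a = pmf \<mu> 1" and "p = pmf \<mu> 2" and "q = pmf \<mu> 3"
  note defs = a_def[symmetric] p_def[symmetric] q_def[symmetric]
  have pos: "0 < a" "0 < p" "0 < q" and sum: "a = 1 - p - 2 * q" and less': "a < p" "p < 1 / 2"
    using law(3-6) less half unfolding defs by auto
  \<comment> \<open>The first bound is what remains with only class 1 present, where the quadratic
    term uses up half of \<open>p - a\<close>; the second is for class 2 present.\<close>
  define \<epsilon> where "\<epsilon> = min ((p - a) / 2) (1 - 2 * p)"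
  have \<epsilon>: "0 < \<epsilon>" "\<epsilon> \<le> (p - a) / 2" "\<epsilon> \<le> 1 - 2 * p"
    using less' by (auto simp: \<epsilon>_def min_def field_simps)
  \<comment> \<open>While items of class 1 are present, those of classes 3 and 4 together perform a reflected
    symmetric random walk; the quadratic term has a small drift there and, for large \<open>y\<close>, a
    very negative one when class 1 is absent.\<close>
  define \<kappa> where "\<kappa> = (p - a) / (4 * q)"
  have \<kappa>: "0 < \<kappa>" "4 * (\<kappa> * q) = p - a"
    using less' pos by (auto simp: \<kappa>_def)
  obtain Y :: nat where "(a + \<kappa> * q + \<epsilon>) / (p * \<kappa>) \<le> Y"
    using real_arch_simple by blast
  then have Y: "a + \<kappa> * q + \<epsilon> \<le> p * \<kappa> * Y"
    using pos \<kappa> by (simp add: field_simps)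
  \<comment> \<open>The bounded term \<open>C * g\<close> repairs the drift at the finitely many states with \<open>y \<le> Y\<close> and no
    item of class 1, from which the empty state is reached with positive probability.\<close>
  define C where "C = (a + \<kappa> * q + \<epsilon>) / (q * p ^ Y)"
  have C: "0 < C" "C * (q * p ^ Y) = a + \<kappa> * q + \<epsilon>"
    using pos \<kappa> \<epsilon> by (auto simp: C_def intro!: divide_pos_pos add_pos_pos)
  \<comment> \<open>\<open>p ^ y\<close> is the probability that the next \<open>y\<close> arrivals
    are all of class 2, which empties a buffer holding just \<open>y\<close> items of classes 3 and
    4.\<close>
  define g :: "nat \<Rightarrow> nat \<Rightarrow> real" where "g n y = (if n = 0 then 1 - p ^ y else 1)" for n y
  have g: "0 \<le> g n y" "g n y \<le> 1" for n y
    using pos less' by (auto simp: g_def power_le_one)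
  define F :: "nat \<Rightarrow> nat \<Rightarrow> nat \<Rightarrow> real" where
    "F n k y = n + k + \<kappa> * (y * (y + 1) / 2) + C * g n y" for n k y
  show ?thesis
  proof (rule stable_if_drift[OF simple_graph_paw law(1) \<epsilon>(1),
        where V = "\<lambda>x. F (x 1) (x 2) (x 3 + x 4)"])
    fix x :: "nat \<Rightarrow> nat" assume x: "x \<in> buffer_states paw"
    show "0 \<le> F (x 1) (x 2) (x 3 + x 4)"
      using g(1) \<kappa> C unfolding F_def
      by (intro add_nonneg_nonneg mult_nonneg_nonneg) auto
    let ?\<phi> = "priority_step paw pref x"
    let ?E = "measure_pmf.expectation \<mu> (\<lambda>i. F (?\<phi> i 1) (?\<phi> i 2) (?\<phi> i 3 + ?\<phi> i 4))"
    note E = paw_expectation_2_present[OF pref x \<mu> refl, where F = F]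
      paw_expectation_only_1[OF pref x \<mu> refl, where F = F]
      paw_expectation_34_present[OF pref x \<mu> refl, where F = F]
      paw_removes_34[OF pref x \<mu> refl, where F = F]
      paw_removes_1[OF pref x \<mu> refl, where F = F]
    assume "x \<noteq> (\<lambda>_. 0)"
    with x show "?E \<le> F (x 1) (x 2) (x 3 + x 4) - \<epsilon>"
    proof (cases rule: paw_cases)
      case (2 k)
      then have k: "0 < x 2" by simp
      have "?E = F (x 1) (x 2) (x 3 + x 4) - (1 - 2 * p)"
        unfolding E(1)[OF k] using 2 by (simp add: F_def g_def defs algebra_simps)
      then show ?thesis using \<epsilon> by simp
    next
      case (34 y)
      then have y: "0 < x 3 + x 4" by simp
      show ?thesis
      proof (cases "x 1")
        case 0
        \<comment> \<open>The buffer holds \<open>y + 1\<close> items of classes 3 and 4: it moves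
          to \<open>y\<close> with probability \<open>p + q\<close> and to \<open>y + 2\<close> with
          probability \<open>q\<close>; an arrival of class 1 leads to \<open>g = 1\<close>.\<close>
        have "?E = F (x 1) (x 2) (x 3 + x 4) + (a + \<kappa> * q - p * \<kappa> * (1 + y))
            + C * (a + (p + q) * g 0 y + q * g 0 (y + 2) - g 0 (y + 1))"
          unfolding E(3)[OF y] E(4)[OF y disjI1[OF 0]] using 0 34
          by (simp add: F_def g_def defs sum field_simps power_add)
        \<comment> \<open>The class 2 term cancels \<open>p ^ (y + 1)\<close> from the current
          state; \<open>- q * p ^ y\<close> and a further negative term remain.\<close>
        moreover have "a + (p + q) * g 0 y + q * g 0 (y + 2) - g 0 (y + 1) \<le> - (q * p ^ y)"
          using pos by (simp add: g_def sum power_add algebra_simps)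
        then have "C * (a + (p + q) * g 0 y + q * g 0 (y + 2) - g 0 (y + 1)) \<le> C * (- (q * p ^ y))"
          using C by (intro mult_left_mono) auto
        \<comment> \<open>Up to \<open>Y\<close> the correction pays, as \<open>C\<close> is
          normalised at \<open>Y\<close>, where \<open>q * p ^ y\<close> is smallest; beyond
          \<open>Y\<close> the quadratic term does.\<close>
        moreover have "a + \<kappa> * q - p * \<kappa> * (1 + y) - C * (q * p ^ y) \<le> - \<epsilon>"
        proof (cases "y \<le> Y")
          case True
          then have "C * (q * p ^ Y) \<le> C * (q * p ^ y)"
            using C pos less' by (intro mult_left_mono power_decreasing) auto
          moreover have "0 \<le> p * \<kappa> * (1 + y)"
            using pos \<kappa> by simp
          ultimately show ?thesis using C by linarith
        next
          case False
          then have "p * \<kappa> * Y \<le> p * \<kappa> * (1 + y)"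
            using pos \<kappa> by (intro mult_left_mono) auto
          moreover have "0 \<le> C * (q * p ^ y)"
            using C pos by simp
          ultimately show ?thesis using Y by linarith
        qed
        ultimately show ?thesis by linarith
      next
        case (Suc n)
        then have n: "0 < x 1" by simp
        \<comment> \<open>Here \<open>g\<close> has its maximal value 1; it can only drop, when
          class 2 removes the last item of class 1.\<close>
        have "?E = F (x 1) (x 2) (x 3 + x 4) + (a - p + \<kappa> * q) - C * p * (1 - g n (Suc y))"
          unfolding E(3)[OF y] E(5)[OF n prio] using Suc 34
          by (simp add: F_def g_def[of "Suc _"] defs sum field_simps)
        moreover have "0 \<le> C * p * (1 - g n (Suc y))"
          using C pos g by simp
        moreover have "a - p + \<kappa> * q \<le> - \<epsilon>"
          using \<kappa>(2) \<epsilon>(2) less'(1) by (simp add: field_simps)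
        ultimately show ?thesis by linarith
      qed
    next
      case (1 n)
      then have n: "0 < x 1" by simp
      have "?E = F (x 1) (x 2) (x 3 + x 4) + (a - p + 2 * (\<kappa> * q)) - C * p * (1 - g n 0)"
        unfolding E(2)[OF n 1(3)] using 1 by (simp add: F_def g_def[of "Suc _"] defs sum field_simps)
      moreover have "0 \<le> C * p * (1 - g n 0)"
        using C pos g by simp
      moreover have "a - p + 2 * (\<kappa> * q) \<le> - \<epsilon>"
        using \<kappa>(2) \<epsilon>(2) by (simp add: field_simps)
      ultimately show ?thesis by linarith
    qed
  qed
qed

theorem proposition3:
  fixes A B :: "nat \<Rightarrow> nat rel"
  assumes "policy_A A" and "policy_B B"
  shows "Stab A = Ncond_laws \<inter> {\<mu>. pmf \<mu> 1 * (1 - pmf \<mu> 1) < (pmf \<mu> 2)\<^sup>2}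
    \<and> Stab B = Ncond_laws"
proof
  have pref: "preferences paw A" "preferences paw B"
    using assms by (simp_all add: policy_A_def policy_B_def)
  \<comment> \<open>For policy A the first half of \<open>Ncond\<close> is a consequence of the
    quadratic inequality, by dropping the term with \<open>pmf \<mu> 3\<close>.\<close>
  have "pmf \<mu> 1 < pmf \<mu> 2"
    if \<mu>: "\<mu> \<in> symmetric_laws" and less: "pmf \<mu> 1 * (1 - pmf \<mu> 1) < (pmf \<mu> 2)\<^sup>2" for \<mu>
  proof -
    have "0 \<le> 2 * pmf \<mu> 1 * pmf \<mu> 3"
      by simp
    then have "pmf \<mu> 1 * pmf \<mu> 2 < pmf \<mu> 2 * pmf \<mu> 2"
      using less unfolding policy_A_criterion[OF \<mu>] power2_eq_square by linarith
    then show ?thesis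
      using symmetric_laws(4)[OF \<mu>] by simp
  qed
  then show "Stab A = Ncond_laws \<inter> {\<mu>. pmf \<mu> 1 * (1 - pmf \<mu> 1) < (pmf \<mu> 2)\<^sup>2}"
    using policy_A_stable[OF assms(1)] policy_A_stable_imp[OF assms(1)]
      stable_paw_imp_less_half[OF pref(1)] Ncond_paw_iff
    unfolding Stab_def Ncond_laws_def by blast
  show "Stab B = Ncond_laws"
    using policy_B_stable[OF assms(2)] policy_B_stable_imp[OF assms(2)]
      stable_paw_imp_less_half[OF pref(2)] Ncond_paw_iff
    unfolding Stab_def Ncond_laws_def by blast
qed

end
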